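(* Let $\Gamma$ be a countable discrete group, let $M$ be a finite von Neumann algebra with a $\Gamma$-action which admits a faithful normal finite $\Gamma$-invariant trace, and let $[p],[q]\in P(M)/{\sim}_{\mathrm{MvN}}$ be the Murray–von Neumann classes of projections $p,q\in P(M)$. Then $[p]$ and $[q]$ agree on every finite $\Gamma$-invariant trace on $M$ (that is, $\tau(p)=\tau(q)$ for every finite $\Gamma$-invariant trace $\tau$ on $M$) if and only if $[p]$ and $[q]$ are equidecomposable, i.e. there are classes $([p_\gamma])_{\gamma\in\Gamma}$ in $P(M)/{\sim}_{\mathrm{MvN}}$ such that $[p]=\sum_\gamma[p_\gamma]$ and $[q]=\sum_\gamma\gamma[p_\gamma]$.
   Context: A von Neumann algebra is a weakly closed $*$-subalgebra $M$ of $B(H)$ containing the identity. An element $x\in M$ is positive if $x=yy^*$ for some $y\in M$; $M_+$ is the set of positive elements, and $x\le y$ means that $y-x$ is positive. $P(M)$ is the set of projections of $M$, i.e. elements with $p=p^*=p^2$. Projections $p,q$ are Murray–von Neumann equivalent, $p\sim_{\mathrm{MvN}}q$, if $p=uu^*$ and $q=u^*u$ for some $u\in M$. A projection $p$ is finite if for any projection $p'$, $p\sim_{\mathrm{MvN}}p'\le p$ implies $p=p'$; $M$ is finite if $1_M$ is a finite projection. A trace on $M$ is a map $\tau:M_+\to[0,\infty]$ which is additive, positively homogeneous, and satisfies $\tau(mm^* )=\tau(m^*m)$ for all $m\in M$. It is finite if its image is contained in $[0,\infty)$, faithful if $\tau(m)=0$ implies $m=0$, and normal if it is weakly continuous. A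 $\Gamma$-action on $M$ is an action of $\Gamma$ on $M$ by weakly continuous maps preserving $+,0,\cdot,1,{}^*$. A trace $\tau$ is $\Gamma$-invariant if $\tau(\gamma m)=\tau(m)$ for all $m\in M_+$ and $\gamma\in\Gamma$. $P(M)/{\sim}_{\mathrm{MvN}}$ carries a partial countable addition by joins of orthogonal projections: for a countable family of classes $([p_i])_{i\in I}$, the sum $\sum_i[p_i]$ is defined if there are mutually orthogonal projections $p_i'\in P(M)$ with $p_i'\sim_{\mathrm{MvN}}p_i$ for all $i$, and then $\sum_i[p_i]=[\bigvee_i p_i']$. (This makes it a generalized cardinal algebra in the sense of Tarski.) $\Gamma$ acts on it by $\gamma[p]=[\gamma p]$.
   Formalization: "Every finite Γ-invariant trace" is read as "every finite normal Γ-invariant trace": for non-normal traces, countably equidecomposable classes can have different traces, so the statement is false as written. Weak continuity is taken to be ultraweak continuity. *)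

theory Defs
  imports "HOL-Analysis.Analysis" "HOL-Algebra.Group_Action"
begin

section \<open>Complex Hilbert spaces and bounded operators\<close>

text \<open>
  The inner product \<open>cinner\<close> is linear in the first argument. The real inner product and the norm of
  the underlying real Hilbert space are the induced ones, so positive definiteness is inherited
  from \<open>real_inner\<close>.
\<close>

class chilbert_space = real_inner + complete_space +
  fixes scaleC :: "complex \<Rightarrow> 'a \<Rightarrow> 'a" (infixr "*\<^sub>C" 75)
    and cinner :: "'a \<Rightarrow> 'a \<Rightarrow> complex"
  assumes scaleC_add_right: "c *\<^sub>C (x + y) = c *\<^sub>C x + c *\<^sub>C y"
    and scaleC_add_left: "(c + d) *\<^sub>C x = c *\<^sub>C x + d *\<^sub>C x"
    and scaleC_scaleC: "c *\<^sub>C d *\<^sub>C x = (c * d) *\<^sub>C x"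
    and scaleR_scaleC: "r *\<^sub>R x = complex_of_real r *\<^sub>C x"
    and cinner_commute: "cinner x y = cnj (cinner y x)"
    and cinner_add_left: "cinner (x + y) z = cinner x z + cinner y z"
    and cinner_scaleC_left: "cinner (c *\<^sub>C x) y = c * cinner x y"
    and inner_cinner: "inner x y = Re (cinner x y)"

lemma cinner_scaleC_right: "cinner (x::'a::chilbert_space) (c *\<^sub>C y) = cnj c * cinner x y"
proof -
  have "cinner x (c *\<^sub>C y) = cnj (c * cinner y x)"
    by (subst cinner_commute) (simp add: cinner_scaleC_left)
  also have "\<dots> = cnj c * cnj (cinner y x)"
    by simp
  also have "cnj (cinner y x) = cinner x y"
    by (rule cinner_commute [symmetric])
  finally show ?thesis .
qed

lemma norm_scaleC: "norm (c *\<^sub>C (x::'a::chilbert_space)) = cmod c * norm x"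
proof -
  have "inner (c *\<^sub>C x) (c *\<^sub>C x) = Re ((c * cnj c) * cinner x x)"
    by (simp only: inner_cinner cinner_scaleC_left cinner_scaleC_right mult_ac)
  also have "\<dots> = (cmod c)\<^sup>2 * inner x x"
    by (simp only: complex_norm_square [symmetric] inner_cinner Re_complex_of_real
        flip: of_real_power) simp
  finally show ?thesis
    by (simp add: norm_eq_sqrt_inner real_sqrt_mult)
qed

lemma bounded_linear_scaleC: "bounded_linear (\<lambda>x::'a::chilbert_space. c *\<^sub>C x)"
proof (rule bounded_linear_intro)
  show "c *\<^sub>C (r *\<^sub>R x) = r *\<^sub>R (c *\<^sub>C x)" for r x
    by (simp add: scaleR_scaleC scaleC_scaleC mult.commute)
  show "norm (c *\<^sub>C x) \<le> norm x * cmod c" for x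
    by (simp add: norm_scaleC)
qed (rule scaleC_add_right)

text \<open>\<open>B(H)\<close>, as a set of bounded real-linear operators.\<close>

definition bounded_ops :: "('h::chilbert_space \<Rightarrow>\<^sub>L 'h) set" where
  "bounded_ops = {T. \<forall>c x. blinfun_apply T (c *\<^sub>C x) = c *\<^sub>C blinfun_apply T x}"

lift_definition scaleC_op :: "complex \<Rightarrow> ('h::chilbert_space \<Rightarrow>\<^sub>L 'h) \<Rightarrow> ('h \<Rightarrow>\<^sub>L 'h)"
  is "\<lambda>c T x. c *\<^sub>C T x"
  by (rule bounded_linear_compose [OF bounded_linear_scaleC])

definition adj :: "('h::chilbert_space \<Rightarrow>\<^sub>L 'h) \<Rightarrow> ('h \<Rightarrow>\<^sub>L 'h)" where
  "adj T = (THE S. \<forall>x y. cinner (blinfun_apply T x) y = cinner x (blinfun_apply S y))"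

definition weak_operator_topology :: "('h::chilbert_space \<Rightarrow>\<^sub>L 'h) topology" where
  "weak_operator_topology = topology_generated_by
     {{T. cinner (blinfun_apply T x) y \<in> U} | x y U. open U}"

text \<open>
  The ultraweak (\<open>\<sigma>\<close>-weak, weak-\<open>*\<close>) topology. It agrees with the weak operator topology on norm
  bounded sets; weak continuity of maps on a von Neumann algebra refers to it.
\<close>

definition ultraweak_topology :: "('h::chilbert_space \<Rightarrow>\<^sub>L 'h) topology" where
  "ultraweak_topology = topology_generated_by
     {{T. (\<Sum>n. cinner (blinfun_apply T (x n)) (y n)) \<in> U} | (x :: nat \<Rightarrow> 'h) (y :: nat \<Rightarrow> 'h) U.
        summable (\<lambda>n. (norm (x n))\<^sup>2) \<and> summable (\<lambda>n. (norm (y n))\<^sup>2) \<and> open U}"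


section \<open>Von Neumann algebras, projections and Murray--von Neumann equivalence\<close>

definition von_neumann_algebra :: "('h::chilbert_space \<Rightarrow>\<^sub>L 'h) set \<Rightarrow> bool" where
  "von_neumann_algebra M \<longleftrightarrow>
     M \<subseteq> bounded_ops \<and>
     id_blinfun \<in> M \<and>
     (\<forall>x\<in>M. \<forall>y\<in>M. x + y \<in> M) \<and>
     (\<forall>c. \<forall>x\<in>M. scaleC_op c x \<in> M) \<and>
     (\<forall>x\<in>M. \<forall>y\<in>M. x o\<^sub>L y \<in> M) \<and>
     (\<forall>x\<in>M. adj x \<in> M) \<and>
     closedin (subtopology weak_operator_topology bounded_ops) M"

definition positives :: "('h::chilbert_space \<Rightarrow>\<^sub>L 'h) set \<Rightarrow> ('h \<Rightarrow>\<^sub>L 'h) set" where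
  "positives M = {x \<in> M. \<exists>y\<in>M. x = y o\<^sub>L adj y}"

definition le_op :: "('h::chilbert_space \<Rightarrow>\<^sub>L 'h) set \<Rightarrow> ('h \<Rightarrow>\<^sub>L 'h) \<Rightarrow> ('h \<Rightarrow>\<^sub>L 'h) \<Rightarrow> bool" where
  "le_op M x y \<longleftrightarrow> y - x \<in> positives M"

definition projections :: "('h::chilbert_space \<Rightarrow>\<^sub>L 'h) set \<Rightarrow> ('h \<Rightarrow>\<^sub>L 'h) set" where
  "projections M = {p \<in> M. adj p = p \<and> p o\<^sub>L p = p}"

definition mvn_rel :: "('h::chilbert_space \<Rightarrow>\<^sub>L 'h) set \<Rightarrow> (('h \<Rightarrow>\<^sub>L 'h) \<times> ('h \<Rightarrow>\<^sub>L 'h)) set" where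
  "mvn_rel M = {(p, q). p \<in> projections M \<and> q \<in> projections M \<and>
     (\<exists>u\<in>M. p = u o\<^sub>L adj u \<and> q = adj u o\<^sub>L u)}"

definition mvn_class :: "('h::chilbert_space \<Rightarrow>\<^sub>L 'h) set \<Rightarrow> ('h \<Rightarrow>\<^sub>L 'h) \<Rightarrow> ('h \<Rightarrow>\<^sub>L 'h) set" where
  "mvn_class M p = mvn_rel M `` {p}"

definition mvn_classes :: "('h::chilbert_space \<Rightarrow>\<^sub>L 'h) set \<Rightarrow> ('h \<Rightarrow>\<^sub>L 'h) set set" where
  "mvn_classes M = projections M // mvn_rel M"

definition finite_projection :: "('h::chilbert_space \<Rightarrow>\<^sub>L 'h) set \<Rightarrow> ('h \<Rightarrow>\<^sub>L 'h) \<Rightarrow> bool" where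
  "finite_projection M p \<longleftrightarrow> p \<in> projections M \<and>
     (\<forall>p'\<in>projections M. (p, p') \<in> mvn_rel M \<and> le_op M p' p \<longrightarrow> p = p')"

definition finite_vna :: "('h::chilbert_space \<Rightarrow>\<^sub>L 'h) set \<Rightarrow> bool" where
  "finite_vna M \<longleftrightarrow> finite_projection M id_blinfun"


section \<open>Traces\<close>

text \<open>
  A trace is represented by a function on all operators, of which only the values on \<open>M\<^sub>+\<close> are used.
  The factor \<open>0\<close> is allowed in homogeneity, with \<open>0 * \<infinity> = 0\<close>.
\<close>

definition vna_trace :: "('h::chilbert_space \<Rightarrow>\<^sub>L 'h) set \<Rightarrow> (('h \<Rightarrow>\<^sub>L 'h) \<Rightarrow> ennreal) \<Rightarrow> bool" where
  "vna_trace M \<tau> \<longleftrightarrow>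
     (\<forall>x\<in>positives M. \<forall>y\<in>positives M. \<tau> (x + y) = \<tau> x + \<tau> y) \<and>
     (\<forall>c\<ge>0. \<forall>x\<in>positives M. \<tau> (c *\<^sub>R x) = ennreal c * \<tau> x) \<and>
     (\<forall>m\<in>M. \<tau> (m o\<^sub>L adj m) = \<tau> (adj m o\<^sub>L m))"

definition finite_trace :: "('h::chilbert_space \<Rightarrow>\<^sub>L 'h) set \<Rightarrow> (('h \<Rightarrow>\<^sub>L 'h) \<Rightarrow> ennreal) \<Rightarrow> bool" where
  "finite_trace M \<tau> \<longleftrightarrow> (\<forall>x\<in>positives M. \<tau> x < \<infinity>)"

definition faithful_trace :: "('h::chilbert_space \<Rightarrow>\<^sub>L 'h) set \<Rightarrow> (('h \<Rightarrow>\<^sub>L 'h) \<Rightarrow> ennreal) \<Rightarrow> bool" where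
  "faithful_trace M \<tau> \<longleftrightarrow> (\<forall>x\<in>positives M. \<tau> x = 0 \<longrightarrow> x = 0)"

definition normal_trace :: "('h::chilbert_space \<Rightarrow>\<^sub>L 'h) set \<Rightarrow> (('h \<Rightarrow>\<^sub>L 'h) \<Rightarrow> ennreal) \<Rightarrow> bool" where
  "normal_trace M \<tau> \<longleftrightarrow> continuous_map (subtopology ultraweak_topology (positives M)) euclidean \<tau>"


section \<open>Group actions\<close>

text \<open>
  Only the ring operations and the involution are required to be preserved, so conjugate-linear
  automorphisms are admitted.
\<close>

definition vna_action ::
  "('g, 'm) monoid_scheme \<Rightarrow> ('h::chilbert_space \<Rightarrow>\<^sub>L 'h) set \<Rightarrow> ('g \<Rightarrow> ('h \<Rightarrow>\<^sub>L 'h) \<Rightarrow> ('h \<Rightarrow>\<^sub>L 'h)) \<Rightarrow> bool"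
  where
  "vna_action \<Gamma> M \<alpha> \<longleftrightarrow> group_action \<Gamma> M \<alpha> \<and>
     (\<forall>\<gamma>\<in>carrier \<Gamma>.
        continuous_map (subtopology ultraweak_topology M) (subtopology ultraweak_topology M) (\<alpha> \<gamma>) \<and>
        (\<forall>x\<in>M. \<forall>y\<in>M. \<alpha> \<gamma> (x + y) = \<alpha> \<gamma> x + \<alpha> \<gamma> y) \<and>
        \<alpha> \<gamma> 0 = 0 \<and>
        (\<forall>x\<in>M. \<forall>y\<in>M. \<alpha> \<gamma> (x o\<^sub>L y) = \<alpha> \<gamma> x o\<^sub>L \<alpha> \<gamma> y) \<and>
        \<alpha> \<gamma> id_blinfun = id_blinfun \<and>
        (\<forall>x\<in>M. \<alpha> \<gamma> (adj x) = adj (\<alpha> \<gamma> x)))"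

definition invariant_trace ::
  "('g, 'm) monoid_scheme \<Rightarrow> ('h::chilbert_space \<Rightarrow>\<^sub>L 'h) set \<Rightarrow> ('g \<Rightarrow> ('h \<Rightarrow>\<^sub>L 'h) \<Rightarrow> ('h \<Rightarrow>\<^sub>L 'h)) \<Rightarrow>
   (('h \<Rightarrow>\<^sub>L 'h) \<Rightarrow> ennreal) \<Rightarrow> bool" where
  "invariant_trace \<Gamma> M \<alpha> \<tau> \<longleftrightarrow> (\<forall>\<gamma>\<in>carrier \<Gamma>. \<forall>m\<in>positives M. \<tau> (\<alpha> \<gamma> m) = \<tau> m)"

definition class_action ::
  "('h::chilbert_space \<Rightarrow>\<^sub>L 'h) set \<Rightarrow> ('g \<Rightarrow> ('h \<Rightarrow>\<^sub>L 'h) \<Rightarrow> ('h \<Rightarrow>\<^sub>L 'h)) \<Rightarrow>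
   'g \<Rightarrow> ('h \<Rightarrow>\<^sub>L 'h) set \<Rightarrow> ('h \<Rightarrow>\<^sub>L 'h) set" where
  "class_action M \<alpha> \<gamma> c = (\<Union>p\<in>c. mvn_class M (\<alpha> \<gamma> p))"


section \<open>Partial countable addition of classes and equidecomposability\<close>

definition is_join ::
  "('h::chilbert_space \<Rightarrow>\<^sub>L 'h) set \<Rightarrow> 'i set \<Rightarrow> ('i \<Rightarrow> ('h \<Rightarrow>\<^sub>L 'h)) \<Rightarrow> ('h \<Rightarrow>\<^sub>L 'h) \<Rightarrow> bool" where
  "is_join M I p s \<longleftrightarrow> s \<in> projections M \<and> (\<forall>i\<in>I. le_op M (p i) s) \<and>
     (\<forall>r\<in>projections M. (\<forall>i\<in>I. le_op M (p i) r) \<longrightarrow> le_op M s r)"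

text \<open>\<open>class_sum M I a c\<close>: the sum of the classes \<open>a i\<close>, \<open>i \<in> I\<close>, is defined and equals \<open>c\<close>.\<close>

definition class_sum ::
  "('h::chilbert_space \<Rightarrow>\<^sub>L 'h) set \<Rightarrow> 'i set \<Rightarrow> ('i \<Rightarrow> ('h \<Rightarrow>\<^sub>L 'h) set) \<Rightarrow> ('h \<Rightarrow>\<^sub>L 'h) set \<Rightarrow> bool" where
  "class_sum M I a c \<longleftrightarrow> countable I \<and> (\<forall>i\<in>I. a i \<in> mvn_classes M) \<and>
     (\<exists>p s. (\<forall>i\<in>I. p i \<in> a i) \<and>
            (\<forall>i\<in>I. \<forall>j\<in>I. i \<noteq> j \<longrightarrow> p i o\<^sub>L p j = 0) \<and>
            is_join M I p s \<and> c = mvn_class M s)"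

definition equidecomposable ::
  "('g, 'm) monoid_scheme \<Rightarrow> ('h::chilbert_space \<Rightarrow>\<^sub>L 'h) set \<Rightarrow> ('g \<Rightarrow> ('h \<Rightarrow>\<^sub>L 'h) \<Rightarrow> ('h \<Rightarrow>\<^sub>L 'h)) \<Rightarrow>
   ('h \<Rightarrow>\<^sub>L 'h) set \<Rightarrow> ('h \<Rightarrow>\<^sub>L 'h) set \<Rightarrow> bool" where
  "equidecomposable \<Gamma> M \<alpha> c d \<longleftrightarrow>
     (\<exists>a. (\<forall>\<gamma>\<in>carrier \<Gamma>. a \<gamma> \<in> mvn_classes M) \<and>
          class_sum M (carrier \<Gamma>) a c \<and>
          class_sum M (carrier \<Gamma>) (\<lambda>\<gamma>. class_action M \<alpha> \<gamma> (a \<gamma>)) d)"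

text \<open>
  Agreement of classes is tested on the finite invariant traces that are normal, that is, on those
  which are countably additive on \<open>P(M)/\<sim>\<close>. Without normality, countable equidecompositions need
  not preserve traces: let \<open>\<Gamma>\<close> be the direct sum of copies of \<open>\<int>/2\<close>, indexed by the natural numbers,
  with the \<open>k\<close>-th generator exchanging \<open>a k\<close> and \<open>b k\<close> in \<open>\<ell>\<^sup>\<infinity>({a k, b k | k})\<close>; then the indicators
  of \<open>{a k | k}\<close> and \<open>{b k | k}\<close> are equidecomposable but are separated by the invariant
  trace that takes \<open>f\<close> to the limit of \<open>f (a k)\<close> along a free ultrafilter.
\<close>

end

theory Submission
  imports Defs
begin

text \<open>
  A maximal family of pieces \<open>(e, f, \<gamma>)\<close>, with \<open>e \<le> p\<close> and \<open>f \<le> q\<close> nonzero and \<open>\<gamma> e \<sim> f\<close>, leaves remainders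
  \<open>p'\<close> and \<open>q'\<close> that have no such piece in common. By comparison of projections, the invariant
  central support \<open>z\<close> of \<open>p'\<close> is then orthogonal to \<open>q'\<close>, so the invariant trace \<open>\<lambda>x. \<tau> (z x z)\<close>, which
  agrees on \<open>p\<close> and \<open>q\<close> and on the matched parts, gives \<open>\<tau> p' = 0\<close>. Hence \<open>p' = 0\<close>, and comparing the values
  of \<open>\<tau>\<close> itself gives \<open>q' = 0\<close>.
\<close>

section \<open>Complex Hilbert spaces and adjoints\<close>

text \<open>Comparison rests on the partial isometry in the polar decomposition of a nonzero corner
  \<open>a x b\<close>. It is found without spectral theory: polynomial expressions in an operator
  and its adjoint converge strongly to it, so closedness of \<open>M\<close> keeps the limit in
  \<open>M\<close>. The automorphisms may be conjugate-linear; they are therefore handled through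
  products, adjoints and the order of projections, and operator identities are mostly checked with
  the real inner product. Compression by \<open>z\<close> is a trace because \<open>z\<close> is
  central, and an invariant one because \<open>z\<close> is invariant; hence the support has to
  absorb translates and equivalent projections, not just \<open>p'\<close>. Finiteness of the traces
  allows the matched part to be cancelled. The maximal family may be uncountable; grouping its
  pieces by their group element gives the family over \<Gamma> that equidecomposability asks for. In
  the converse direction normality makes a trace additive over orthogonal joins, and by invariance
  both sums have the same terms.\<close>

lemma cinner_add_right: "cinner (x::'a::chilbert_space) (y + z) = cinner x y + cinner x z"
  by (metis cinner_add_left cinner_commute complex_cnj_add)

lemma Re_cinner: "Re (cinner x y) = inner x (y::'a::chilbert_space)"
  by (simp add: inner_cinner)

lemma Im_cinner: "Im (cinner x y) = inner x (\<i> *\<^sub>C (y::'a::chilbert_space))"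
  by (simp add: inner_cinner cinner_scaleC_right)

text \<open>Real and imaginary part of the complex inner product are real inner products, with
  \<open>y\<close> and with \<open>\<i> *\<^sub>C y\<close>. This reduces complex identities to the
  underlying real Hilbert space.\<close>

lemma cinner_eqI:
  assumes "\<And>c. inner x (c *\<^sub>C y) = inner x' (c *\<^sub>C (y'::'a::chilbert_space))"
  shows "cinner x y = cinner x' y'"
proof (rule complex_eqI)
  show "Re (cinner x y) = Re (cinner x' y')"
    using assms [of 1] by (simp add: inner_cinner cinner_scaleC_right)
  show "Im (cinner x y) = Im (cinner x' y')"
    using assms [of \<i>] by (simp add: Im_cinner)
qed

text \<open>The factor 2 comes from bounding real and imaginary part separately. The sharp constant
  1 would gain nothing, as only continuity and summability are deduced.\<close>

lemma norm_cinner_le: "norm (cinner x (y::'a::chilbert_space)) \<le> 2 * norm x * norm y"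
proof -
  have "norm (cinner x y) \<le> \<bar>inner x y\<bar> + \<bar>inner x (\<i> *\<^sub>C y)\<bar>"
    using cmod_le [of "cinner x y"] by (simp add: Re_cinner Im_cinner)
  also have "\<dots> \<le> norm x * norm y + norm x * norm (\<i> *\<^sub>C y)"
    by (intro add_mono Cauchy_Schwarz_ineq2)
  finally show ?thesis
    by (simp add: norm_scaleC)
qed

lemma bounded_bilinear_cinner:
  "bounded_bilinear (cinner :: 'a::chilbert_space \<Rightarrow> 'a \<Rightarrow> complex)"
proof
  fix x x' y y' :: 'a and r :: real
  show "cinner (r *\<^sub>R x) y = r *\<^sub>R cinner x y"
    by (simp add: scaleR_scaleC cinner_scaleC_left scaleR_conv_of_real)
  show "cinner x (r *\<^sub>R y) = r *\<^sub>R cinner x y"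
    by (simp add: scaleR_scaleC cinner_scaleC_right scaleR_conv_of_real)
  have "norm (cinner a b) \<le> norm a * norm b * 2" for a b :: 'a
    using norm_cinner_le [of a b] by (simp add: mult_ac)
  then show "\<exists>K. \<forall>a b::'a. norm (cinner a b) \<le> norm a * norm b * K"
    by blast
qed (rule cinner_add_left cinner_add_right)+

lemma tendsto_cinner:
  assumes "(f \<longlongrightarrow> a) F" "(g \<longlongrightarrow> (b::'a::chilbert_space)) F"
  shows "((\<lambda>i. cinner (f i) (g i)) \<longlongrightarrow> cinner a b) F"
  using assms by (rule bounded_bilinear.tendsto [OF bounded_bilinear_cinner])

section \<open>Riesz representation and existence of adjoints\<close>

lemma parallelogram_law:
  "(norm (x + y))\<^sup>2 + (norm (x - y))\<^sup>2 = 2 * (norm x)\<^sup>2 + 2 * (norm (y::'a::real_inner))\<^sup>2"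
  by (simp add: power2_norm_eq_inner inner_simps inner_commute)

text \<open>
  The representing vector is a multiple of the element of minimal norm in \<open>{x. f x = 1}\<close>; a
  minimizing sequence converges by the parallelogram law.
\<close>

lemma riesz_representation:
  fixes f :: "'a::{real_inner, complete_space} \<Rightarrow> real"
  assumes "bounded_linear f"
  obtains y where "\<And>x. f x = inner x y"
proof (cases "\<forall>x. f x = 0")
  case True
  then show ?thesis
    using that [of 0] by simp
next
  case False
  interpret f: bounded_linear f by fact
  from False obtain x0 where x0: "f x0 \<noteq> 0" by blast
  define C where "C = {x. f x = 1}"
  define d where "d = Inf (norm ` C)"
  have bdd: "bdd_below (norm ` C)"
    by (rule bdd_belowI [of _ 0]) auto
  have ne: "C \<noteq> {}"
    using x0 f.scaleR [of "1 / f x0" x0] by (auto simp: C_def)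
  have d_le: "d \<le> norm x" if "x \<in> C" for x
    unfolding d_def using that bdd by (intro cInf_lower) auto
  have d0: "d \<ge> 0"
    unfolding d_def using ne by (intro cInf_greatest) auto
  have "\<exists>x\<in>C. norm x < d + inverse (Suc n)" for n
    using cInf_lessD [of "norm ` C" "d + inverse (real (Suc n))"] ne d_def by auto
  then obtain X where X: "\<And>n. X n \<in> C" "\<And>n. norm (X n) < d + inverse (Suc n)"
    by metis
  have key: "(norm (x - y))\<^sup>2 \<le> 2 * (norm x)\<^sup>2 + 2 * (norm y)\<^sup>2 - 4 * d\<^sup>2" if "x \<in> C" "y \<in> C" for x y
  proof -
    have "(1/2) *\<^sub>R (x + y) \<in> C"
      using that by (simp add: C_def f.scaleR f.add)
    from d_le [OF this] have "2 * d \<le> norm (x + y)"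
      by simp
    then have "(2 * d)\<^sup>2 \<le> (norm (x + y))\<^sup>2"
      using d0 by (intro power_mono) auto
    then show ?thesis
      using parallelogram_law [of x y] by (simp add: power_mult_distrib)
  qed
  have X_lim: "(\<lambda>n. norm (X n)) \<longlonglongrightarrow> d"
  proof (rule tendsto_sandwich)
    show "\<forall>\<^sub>F n in sequentially. d \<le> norm (X n)"
      using d_le X(1) by simp
    show "\<forall>\<^sub>F n in sequentially. norm (X n) \<le> d + inverse (Suc n)"
      using X(2) by (simp add: less_imp_le)
    show "(\<lambda>n. d + inverse (real (Suc n))) \<longlonglongrightarrow> d"
      using tendsto_add [OF tendsto_const LIMSEQ_inverse_real_of_nat] by force
  qed auto
  have "Cauchy X"
  proof (rule metric_CauchyI)
    fix e :: real assume e: "e > 0"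
    have "(\<lambda>n. (norm (X n))\<^sup>2) \<longlonglongrightarrow> d\<^sup>2"
      by (intro tendsto_intros X_lim)
    moreover have "d\<^sup>2 < d\<^sup>2 + e\<^sup>2 / 4"
      using e by simp
    ultimately have "\<forall>\<^sub>F n in sequentially. (norm (X n))\<^sup>2 < d\<^sup>2 + e\<^sup>2 / 4"
      by (rule order_tendstoD)
    then obtain N where N: "\<And>n. n \<ge> N \<Longrightarrow> (norm (X n))\<^sup>2 < d\<^sup>2 + e\<^sup>2 / 4"
      unfolding eventually_sequentially by blast
    have "dist (X m) (X n) < e" if "m \<ge> N" "n \<ge> N" for m n
    proof -
      have "(norm (X m - X n))\<^sup>2 < e\<^sup>2"
        using key [of "X m" "X n"] X(1) N [OF that(1)] N [OF that(2)] by fastforce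
      then show ?thesis
        using e by (simp add: dist_norm power_less_imp_less_base)
    qed
    then show "\<exists>N. \<forall>m\<ge>N. \<forall>n\<ge>N. dist (X m) (X n) < e"
      by blast
  qed
  then obtain z where z: "X \<longlonglongrightarrow> z"
    by (auto simp: Cauchy_convergent_iff convergent_def)
  have "(\<lambda>n. f (X n)) \<longlonglongrightarrow> f z"
    by (rule f.tendsto [OF z])
  then have fz: "f z = 1"
    using X(1) by (simp add: C_def LIMSEQ_const_iff)
  have nz: "norm z = d"
    using LIMSEQ_unique [OF tendsto_norm [OF z] X_lim] .
  have orth: "inner k z = 0" if k: "f k = 0" for k
  proof (cases "k = 0")
    case False
    \<comment> \<open>This \<open>t\<close> minimizes the norm of \<open>z + t *\<^sub>R k\<close>
      on the line through \<open>z\<close> in direction \<open>k\<close>, which stays in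
      \<open>C\<close>; a nonzero \<open>inner k z\<close> would push that norm below
      \<open>d\<close>.\<close>
    define t where "t = - inner k z / inner k k"
    have "z + t *\<^sub>R k \<in> C"
      using k fz by (simp add: C_def f.add f.scaleR)
    then have "(norm z)\<^sup>2 \<le> (norm (z + t *\<^sub>R k))\<^sup>2"
      using d_le nz by (auto intro!: power_mono)
    then have "0 \<le> 2 * t * inner k z + t * (t * inner k k)"
      by (simp add: power2_norm_eq_inner inner_simps inner_commute)
    also have "t * inner k k = - inner k z"
      using False by (simp add: t_def)
    finally have "0 \<le> t * inner k z"
      by simp
    moreover have "t * inner k z = - (inner k z)\<^sup>2 / inner k k"
      by (simp add: t_def power2_eq_square)
    ultimately have "(inner k z)\<^sup>2 / inner k k \<le> 0"
      by simp
    moreover have "0 < inner k k"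
      using False by simp
    ultimately show ?thesis
      by (simp add: divide_le_0_iff)
  qed simp
  have z0: "inner z z > 0"
    using fz f.zero by auto
  show ?thesis
  proof (rule that [of "(1 / inner z z) *\<^sub>R z"])
    fix x
    have "inner (x - f x *\<^sub>R z) z = 0"
      by (rule orth) (simp add: f.diff f.scaleR fz)
    then show "f x = inner x ((1 / inner z z) *\<^sub>R z)"
      using z0 by (simp add: inner_simps)
  qed
qed

lemma inner_eq_imp_eq:
  assumes "\<And>x. inner x y = inner x (z::'a::real_inner)"
  shows "y = z"
proof -
  have "inner (y - z) (y - z) = 0"
    using assms [of "y - z"] by (simp add: inner_diff_right)
  then show ?thesis by simp
qed

lemma real_adjoint_exists:
  fixes T :: "'a::{real_inner, complete_space} \<Rightarrow>\<^sub>L 'a"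
  shows "\<exists>S. \<forall>x y. inner (T x) y = inner x (blinfun_apply S y)"
proof -
  have "\<exists>z. \<forall>x. inner (T x) y = inner x z" for y
    by (rule riesz_representation [of "\<lambda>x. inner (T x) y"])
      (auto intro!: bounded_linear_intros)
  then obtain g where g: "\<And>x y. inner (T x) y = inner x (g y)"
    by metis
  have "bounded_linear g"
  proof (rule bounded_linear_intro)
    show "g (x + y) = g x + g y" for x y
      by (rule inner_eq_imp_eq) (simp add: inner_add_right flip: g)
    show "g (r *\<^sub>R x) = r *\<^sub>R g x" for r x
      by (rule inner_eq_imp_eq) (simp flip: g)
    show "norm (g x) \<le> norm x * norm T" for x
    proof -
      have "norm (g x) * norm (g x) = inner (T (g x)) x"
        by (simp add: g norm_eq_sqrt_inner)
      also have "\<dots> \<le> norm (T (g x)) * norm x"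
        by (rule norm_cauchy_schwarz)
      also have "\<dots> \<le> norm T * norm (g x) * norm x"
        by (intro mult_right_mono norm_blinfun) auto
      finally have "norm (g x) * norm (g x) \<le> norm (g x) * (norm x * norm T)"
        by (simp add: mult_ac)
      then show ?thesis
        by (cases "norm (g x) = 0") (auto simp: mult_le_cancel_left)
    qed
  qed
  then show ?thesis
    by (intro exI [of _ "Blinfun g"]) (simp add: bounded_linear_Blinfun_apply g)
qed

lemma bounded_opsD: "T \<in> bounded_ops \<Longrightarrow> T (c *\<^sub>C x) = c *\<^sub>C T x"
  by (simp add: bounded_ops_def)

text \<open>\<open>adj\<close> is a definite description over the complex inner product, but a real
  adjoint is enough to identify it: complex linearity of \<open>T\<close> forces \<open>S\<close> to
  be complex linear, and then the real identity, applied to all multiples of \<open>y\<close>, gives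
  the complex one.\<close>

lemma adj_eqI:
  assumes T: "T \<in> bounded_ops" and S: "\<And>x y. inner (T x) y = inner x (blinfun_apply S y)"
  shows "adj T = S"
proof -
  have S_lin: "c *\<^sub>C S y = S (c *\<^sub>C y)" for c y
  proof (rule inner_eq_imp_eq)
    fix x
    have "inner x (c *\<^sub>C S y) = Re (cinner (cnj c *\<^sub>C x) (S y))"
      by (simp add: inner_cinner cinner_scaleC_left cinner_scaleC_right)
    also have "\<dots> = inner (T (cnj c *\<^sub>C x)) y"
      by (simp add: S Re_cinner)
    also have "\<dots> = inner x (S (c *\<^sub>C y))"
      by (simp add: bounded_opsD [OF T] inner_cinner cinner_scaleC_left
          cinner_scaleC_right S [unfolded inner_cinner, symmetric])
    finally show "inner x (c *\<^sub>C S y) = inner x (S (c *\<^sub>C y))" .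
  qed
  show ?thesis
    unfolding adj_def
  proof (rule the_equality)
    show "\<forall>x y. cinner (T x) y = cinner x (S y)"
      by (intro allI cinner_eqI) (simp add: S S_lin)
    fix S' assume "\<forall>x y. cinner (T x) y = cinner x (blinfun_apply S' y)"
    then have "inner x (S' y) = inner x (S y)" for x y
      by (metis Re_cinner S)
    then show "S' = S"
      by (rule blinfun_eqI [OF inner_eq_imp_eq])
  qed
qed

lemma inner_adj:
  assumes "T \<in> bounded_ops"
  shows "inner (T x) y = inner x (adj T y)"
proof -
  obtain S where S: "\<And>x y. inner (T x) y = inner x (blinfun_apply S y)"
    using real_adjoint_exists [of T] by blast
  with assms have "adj T = S"
    by (rule adj_eqI)
  then show ?thesis
    by (simp only: S)
qed


section \<open>Strong limits in a von Neumann algebra\<close>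

text \<open>The sets that contain \<open>f i\<close> eventually, if they contain \<open>l\<close>,
  are closed under finite intersections and arbitrary unions; so convergence can be tested on the
  subbasis.\<close>

lemma limitin_topology_generated_by:
  assumes "l \<in> \<Union>\<B>" and "\<And>U. U \<in> \<B> \<Longrightarrow> l \<in> U \<Longrightarrow> eventually (\<lambda>i. f i \<in> U) F"
  shows "limitin (topology_generated_by \<B>) f l F"
proof -
  have "l \<in> U \<longrightarrow> eventually (\<lambda>i. f i \<in> U) F" if "generate_topology_on \<B> U" for U
    using that
  proof induction
    case (Int a b)
    then show ?case by (auto simp: eventually_conj_iff)
  next
    case (UN K)
    show ?case
    proof
      assume "l \<in> \<Union>K"
      then obtain k where k: "k \<in> K" "l \<in> k" by blast
      with UN have "eventually (\<lambda>i. f i \<in> k) F"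
        by blast
      then show "eventually (\<lambda>i. f i \<in> \<Union>K) F"
        by (rule eventually_mono) (use k in blast)
    qed
  qed (use assms in auto)
  then show ?thesis
    using assms(1) by (simp add: limitin_def openin_topology_generated_by_iff)
qed

lemma limitin_wot:
  assumes "\<And>x y. ((\<lambda>i. cinner (blinfun_apply (T i) x) y) \<longlongrightarrow> cinner (blinfun_apply L x) y) F"
  shows "limitin weak_operator_topology T L F"
  unfolding weak_operator_topology_def
proof (rule limitin_topology_generated_by)
  show "L \<in> \<Union>{{T. cinner (blinfun_apply T x) y \<in> U} |x y U. open U}"
    using open_UNIV by blast
  fix V assume "V \<in> {{T. cinner (blinfun_apply T x) y \<in> U} |x y U. open U}" "L \<in> V"
  then obtain x y U where V: "V = {T. cinner (blinfun_apply T x) y \<in> U}"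
    and U: "open U" "cinner (L x) y \<in> U"
    by blast
  from topological_tendstoD [OF assms U] show "eventually (\<lambda>i. T i \<in> V) F"
    by (simp add: V)
qed

lemma norm_blinfun_apply_le: "norm T \<le> B \<Longrightarrow> norm (blinfun_apply T v) \<le> B * norm v"
  by (rule order_trans [OF norm_blinfun]) (simp add: mult_right_mono)

text \<open>Each term of the defining series converges by strong convergence, and the norm bound
  dominates the series uniformly in \<open>i\<close>, so limit and sum may be exchanged. The factor
  2 of \<open>norm_cinner_le\<close> is absorbed by \<open>2 a b \<le> a^2 + b^2\<close>.\<close>

lemma limitin_ultraweak:
  fixes T :: "'i \<Rightarrow> 'h::chilbert_space \<Rightarrow>\<^sub>L 'h"
  assumes lim: "\<And>v. ((\<lambda>i. T i v) \<longlongrightarrow> blinfun_apply L v) F" and bound: "\<And>i. norm (T i) \<le> B"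
  shows "limitin ultraweak_topology T L F"
  unfolding ultraweak_topology_def
proof (rule limitin_topology_generated_by)
  let ?S = "{{T::'h \<Rightarrow>\<^sub>L 'h. (\<Sum>n. cinner (blinfun_apply T (x n)) (y n)) \<in> U} | (x :: nat \<Rightarrow> 'h) (y :: nat \<Rightarrow> 'h) U.
        summable (\<lambda>n. (norm (x n))\<^sup>2) \<and> summable (\<lambda>n. (norm (y n))\<^sup>2) \<and> open U}"
  have "UNIV \<in> ?S"
    by (rule CollectI, rule exI [of _ "\<lambda>_. 0"], rule exI [of _ "\<lambda>_. 0"], rule exI [of _ UNIV]) auto
  then show "L \<in> \<Union>?S"
    by (rule UnionI) simp
  fix V assume "V \<in> ?S" "L \<in> V"
  then obtain x y U where V: "V = {T. (\<Sum>n. cinner (blinfun_apply T (x n)) (y n)) \<in> U}"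
    and xy: "summable (\<lambda>n. (norm (x n))\<^sup>2)" "summable (\<lambda>n. (norm (y n))\<^sup>2)" and U: "open U"
    by blast
  have "((\<lambda>i. \<Sum>n. cinner (T i (x n)) (y n)) \<longlongrightarrow> (\<Sum>n. cinner (L (x n)) (y n))) F"
  proof (cases "F = bot")
    case False
    show ?thesis
    proof (rule tannerys_theorem [THEN conjunct2, THEN conjunct2])
      show "((\<lambda>i. cinner (T i (x k)) (y k)) \<longlongrightarrow> cinner (L (x k)) (y k)) F" for k
        by (intro tendsto_cinner lim tendsto_const)
      show "summable (\<lambda>k. \<bar>B\<bar> * ((norm (x k))\<^sup>2 + (norm (y k))\<^sup>2))"
        by (intro summable_mult summable_add xy)
      have "norm (cinner (T i (x k)) (y k)) \<le> \<bar>B\<bar> * ((norm (x k))\<^sup>2 + (norm (y k))\<^sup>2)" for i k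
      proof -
        have "norm (cinner (T i (x k)) (y k)) \<le> 2 * norm (T i (x k)) * norm (y k)"
          by (rule norm_cinner_le)
        also have "\<dots> \<le> 2 * (\<bar>B\<bar> * norm (x k)) * norm (y k)"
          using bound [of i] by (intro mult_mono norm_blinfun_apply_le) auto
        also have "\<dots> = \<bar>B\<bar> * (2 * norm (x k) * norm (y k))"
          by simp
        also have "\<dots> \<le> \<bar>B\<bar> * ((norm (x k))\<^sup>2 + (norm (y k))\<^sup>2)"
          by (intro mult_left_mono sum_squares_bound) auto
        finally show ?thesis .
      qed
      then show "\<forall>\<^sub>F (k, i) in at_top \<times>\<^sub>F F. norm (cinner (T i (x k)) (y k)) \<le> \<bar>B\<bar> * ((norm (x k))\<^sup>2 + (norm (y k))\<^sup>2)"
        by (simp add: always_eventually)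
    qed (use False in auto)
  qed simp
  from topological_tendstoD [OF this U] show "eventually (\<lambda>i. T i \<in> V) F"
    using \<open>L \<in> V\<close> by (simp add: V)
qed

locale vna =
  fixes M :: "('h::chilbert_space \<Rightarrow>\<^sub>L 'h) set"
  assumes vna: "von_neumann_algebra M"
begin

lemma bounded_ops: "x \<in> M \<Longrightarrow> x \<in> bounded_ops"
  and id_in [simp]: "id_blinfun \<in> M"
  and add_in [simp]: "x \<in> M \<Longrightarrow> y \<in> M \<Longrightarrow> x + y \<in> M"
  and comp_in [simp]: "x \<in> M \<Longrightarrow> y \<in> M \<Longrightarrow> x o\<^sub>L y \<in> M"
  and adj_in [simp]: "x \<in> M \<Longrightarrow> adj x \<in> M"
  using vna unfolding von_neumann_algebra_def by auto

lemma scaleR_in [simp]: "x \<in> M \<Longrightarrow> r *\<^sub>R x \<in> M"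
proof -
  have "r *\<^sub>R x = scaleC_op (complex_of_real r) x"
    by (rule blinfun_eqI) (simp add: scaleC_op.rep_eq scaleR_blinfun.rep_eq scaleR_scaleC)
  then show "x \<in> M \<Longrightarrow> r *\<^sub>R x \<in> M"
    using vna unfolding von_neumann_algebra_def by simp
qed

lemma diff_in [simp]: "x \<in> M \<Longrightarrow> y \<in> M \<Longrightarrow> x - y \<in> M"
  using add_in [of x "(-1) *\<^sub>R y"] scaleR_in [of y "-1"] by simp

lemma zero_in [simp]: "0 \<in> M"
  using scaleR_in [of id_blinfun 0] by simp

lemma sum_in [simp]: "(\<And>i. i \<in> F \<Longrightarrow> f i \<in> M) \<Longrightarrow> sum f F \<in> M"
  by (induction F rule: infinite_finite_induct) auto

lemma inner_adj_right: "T \<in> M \<Longrightarrow> inner x (adj T y) = inner (T x) y"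
  by (rule inner_adj [OF bounded_ops, symmetric])

lemma inner_adj_left: "T \<in> M \<Longrightarrow> inner (adj T x) y = inner x (T y)"
  by (metis inner_adj_right inner_commute)

lemma adjI: "T \<in> M \<Longrightarrow> (\<And>x y. inner (T x) y = inner x (blinfun_apply S y)) \<Longrightarrow> adj T = S"
  by (rule adj_eqI) (auto intro: bounded_ops)

lemma adj_adj [simp]: "x \<in> M \<Longrightarrow> adj (adj x) = x"
  by (rule adjI) (auto simp: inner_adj_left)

lemma adj_comp [simp]: "x \<in> M \<Longrightarrow> y \<in> M \<Longrightarrow> adj (x o\<^sub>L y) = adj y o\<^sub>L adj x"
  by (rule adjI) (auto simp: inner_adj_right)

lemma adj_add [simp]: "x \<in> M \<Longrightarrow> y \<in> M \<Longrightarrow> adj (x + y) = adj x + adj y"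
  by (rule adjI) (auto simp: inner_adj_right blinfun.add_left inner_add_left inner_add_right)

lemma adj_diff [simp]: "x \<in> M \<Longrightarrow> y \<in> M \<Longrightarrow> adj (x - y) = adj x - adj y"
  by (rule adjI) (auto simp: inner_adj_right blinfun.diff_left inner_diff_left inner_diff_right)

lemma adj_id [simp]: "adj (id_blinfun :: 'h \<Rightarrow>\<^sub>L 'h) = id_blinfun"
  by (rule adjI) auto

lemma adj_zero [simp]: "adj (0 :: 'h \<Rightarrow>\<^sub>L 'h) = 0"
  by (rule adjI) auto

text \<open>Pointwise limits of a bounded net form a bounded linear operator, and strong convergence
  implies weak convergence. Weak closedness of \<open>M\<close> enters the development here; all
  later constructions of elements of \<open>M\<close> by limits go through this lemma.\<close>

lemma strong_limit:
  assumes F: "F \<noteq> bot" and T: "\<And>i. T i \<in> M" and bound: "\<And>i. norm (T i) \<le> B"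
    and conv: "\<And>v. \<exists>w. ((\<lambda>i. T i v) \<longlongrightarrow> w) F"
  shows "\<exists>L\<in>M. \<forall>v. ((\<lambda>i. T i v) \<longlongrightarrow> blinfun_apply L v) F"
proof -
  have "\<exists>l. \<forall>v. ((\<lambda>i. T i v) \<longlongrightarrow> l v) F"
    by (rule choice) (rule allI, rule conv)
  then obtain l where l: "\<And>v. ((\<lambda>i. T i v) \<longlongrightarrow> l v) F"
    by blast
  note uniq = tendsto_unique [OF F]
  have bl: "norm (l x) \<le> norm x * B" for x
  proof (rule tendsto_upperbound [OF tendsto_norm [OF l]])
    have "norm (T i x) \<le> norm x * B" for i
      using norm_blinfun_apply_le [OF bound, of i x] by (simp add: mult.commute)
    then show "\<forall>\<^sub>F i in F. norm (T i x) \<le> norm x * B"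
      by simp
  qed (rule F)
  have bl_l: "bounded_linear l"
  proof (rule bounded_linear_intro)
    show "l (x + y) = l x + l y" for x y
      by (rule uniq [OF l]) (simp add: blinfun.add_right, intro tendsto_add l)
    show "l (r *\<^sub>R x) = r *\<^sub>R l x" for r x
      by (rule uniq [OF l]) (simp add: blinfun.scaleR_right, intro tendsto_scaleR tendsto_const l)
  qed (rule bl)
  define L where "L = Blinfun l"
  have L [simp]: "blinfun_apply L v = l v" for v
    by (simp add: L_def bounded_linear_Blinfun_apply bl_l)
  \<comment> \<open>\<open>M\<close> is closed relative to \<open>bounded_ops\<close> only, so
    complex linearity of the limit has to be established before closedness applies.\<close>
  have Lop: "L \<in> bounded_ops"
    unfolding bounded_ops_def
  proof safe
    fix c x
    have "((\<lambda>i. T i (c *\<^sub>C x)) \<longlongrightarrow> c *\<^sub>C l x) F"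
      unfolding bounded_opsD [OF bounded_ops [OF T]]
      by (rule bounded_linear.tendsto [OF bounded_linear_scaleC l])
    from uniq [OF l this] show "L (c *\<^sub>C x) = c *\<^sub>C L x"
      by simp
  qed
  have "limitin weak_operator_topology T L F"
    by (rule limitin_wot) (simp, intro tendsto_cinner l tendsto_const)
  then have "limitin (subtopology weak_operator_topology bounded_ops) T L F"
    by (simp add: limitin_subtopology Lop bounded_ops T)
  moreover have "closedin (subtopology weak_operator_topology bounded_ops) M"
    using vna by (simp add: von_neumann_algebra_def)
  ultimately have "L \<in> M"
    by (rule limitin_closedin) (simp_all add: F T)
  then show ?thesis
    by (rule bexI [rotated]) (simp add: l)
qed

end


section \<open>Polar decomposition by Newton--Schulz iteration\<close>

lemma blinfun_compose_id [simp]: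
  "T o\<^sub>L id_blinfun = T" "id_blinfun o\<^sub>L T = (T :: 'a::real_normed_vector \<Rightarrow>\<^sub>L 'b::real_normed_vector)"
  by (rule blinfun_eqI, simp)+

text \<open>This is \<open>D^2 \<le> D\<close> for \<open>0 \<le> D \<le> 1\<close>, obtained
  without square roots: \<open>D (1 - D)^2\<close> is positive, being the form of \<open>D\<close>
  at \<open>v - D v\<close>, and \<open>D^3 \<le> D^2\<close>.\<close>

lemma positive_contraction_sq_le:
  fixes D :: "'a::real_inner \<Rightarrow>\<^sub>L 'a"
  assumes sym: "\<And>v w. inner (D v) w = inner v (D w)"
    and pos: "\<And>v. 0 \<le> inner (D v) v" and le: "\<And>v. inner (D v) v \<le> inner v v"
  shows "(norm (D v))\<^sup>2 \<le> inner (D v) v"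
proof -
  have "0 \<le> inner (D (v - D v)) (v - D v)"
    by (rule pos)
  also have "\<dots> = inner (D v) v - 2 * inner (D v) (D v) + inner (D (D v)) (D v)"
    by (simp add: blinfun.diff_right inner_simps sym [of "D v" v])
  also have "\<dots> \<le> inner (D v) v - inner (D v) (D v)"
    using le [of "D v"] by simp
  finally show ?thesis
    by (simp add: power2_norm_eq_inner)
qed

text \<open>Polynomials in \<open>s\<close> with nonnegative coefficients, given by closure rules so
  that their properties follow by induction and no list of coefficients has to be handled.\<close>

inductive_set nnpoly :: "('a::real_normed_vector \<Rightarrow>\<^sub>L 'a) \<Rightarrow> ('a \<Rightarrow>\<^sub>L 'a) set" for s where
  one: "id_blinfun \<in> nnpoly s"
| mult: "T \<in> nnpoly s \<Longrightarrow> s o\<^sub>L T \<in> nnpoly s"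
| add: "T \<in> nnpoly s \<Longrightarrow> U \<in> nnpoly s \<Longrightarrow> T + U \<in> nnpoly s"
| scale: "T \<in> nnpoly s \<Longrightarrow> 0 \<le> r \<Longrightarrow> r *\<^sub>R T \<in> nnpoly s"

lemma nnpoly_self: "s \<in> nnpoly s"
proof -
  have "s o\<^sub>L id_blinfun \<in> nnpoly s"
    by (intro nnpoly.intros)
  then show ?thesis
    by simp
qed

lemma nnpoly_zero: "0 \<in> nnpoly s"
  using nnpoly.scale [OF nnpoly.one, of 0] by simp

lemma nnpoly_comp:
  assumes "T \<in> nnpoly s" "U \<in> nnpoly s"
  shows "T o\<^sub>L U \<in> nnpoly s"
  using assms(1)
proof induction
  case one
  then show ?case using assms(2) by simp
next
  case (mult T)
  have "(s o\<^sub>L T) o\<^sub>L U = s o\<^sub>L (T o\<^sub>L U)"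
    by (rule blinfun_eqI) simp
  then show ?case
    using nnpoly.mult [OF mult.IH] by simp
next
  case (add T T')
  have "(T + T') o\<^sub>L U = (T o\<^sub>L U) + (T' o\<^sub>L U)"
    by (rule blinfun_eqI) (simp add: blinfun.add_left)
  then show ?case
    using nnpoly.add [OF add.IH] by simp
next
  case (scale T r)
  have "(r *\<^sub>R T) o\<^sub>L U = r *\<^sub>R (T o\<^sub>L U)"
    by (rule blinfun_eqI) (simp add: blinfun.scaleR_left)
  then show ?case
    using nnpoly.scale [OF scale.IH scale.hyps(2)] by simp
qed

lemma nnpoly_subst:
  assumes "s' \<in> nnpoly s" "T \<in> nnpoly s'"
  shows "T \<in> nnpoly s"
  using assms(2) by induction (auto intro: nnpoly.intros nnpoly_comp assms(1))

text \<open>Positivity of \<open>(1 - s) T\<close> needs to be known for monomials only. For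
  \<open>s^k\<close> it goes down in steps of two, as
  \<open>s^(k+2) (1 - s) = s (s^k (1 - s)) s\<close> and \<open>s\<close> is symmetric; what remains
  is \<open>1 - s \<ge> 0\<close> and \<open>s - s^2 \<ge> 0\<close>.\<close>

lemma nnpoly_pos:
  fixes s :: "'a::real_inner \<Rightarrow>\<^sub>L 'a"
  assumes sym: "\<And>v w. inner (s v) w = inner v (s w)"
    and pos: "\<And>v. 0 \<le> inner (s v) v" and le: "\<And>v. inner (s v) v \<le> inner v v"
    and T: "T \<in> nnpoly s"
  shows "0 \<le> inner (T v - s (T v)) v"
proof -
  let ?p = "\<lambda>k. blinfun_apply s ^^ k"
  have p_add: "?p k (x + y) = ?p k x + ?p k y" for k x y
    by (induction k) (simp_all add: blinfun.add_right)
  have p_scale: "?p k (r *\<^sub>R x) = r *\<^sub>R ?p k x" for k r x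
    by (induction k) (simp_all add: blinfun.scaleR_right)
  have base: "0 \<le> inner (?p k v - s (?p k v)) v" for k v
  proof (induction k arbitrary: v rule: induct_nat_012)
    case 0
    then show ?case using le [of v] by (simp add: inner_diff_left)
  next
    case 1
    then show ?case
      using positive_contraction_sq_le [OF sym pos le, of v]
      by (simp add: inner_diff_left power2_norm_eq_inner sym [of "s v"])
  next
    case (ge2 k)
    let ?w = "?p k (s v)"
    have "?p (Suc (Suc k)) v = s ?w"
      by (simp add: funpow_swap1)
    then have "inner (?p (Suc (Suc k)) v - s (?p (Suc (Suc k)) v)) v = inner (?w - s ?w) (s v)"
      by (simp add: sym [of _ v] inner_diff_left)
    then show ?case
      using ge2(1) [of "s v"] by simp
  qed
  \<comment> \<open>The power \<open>k\<close> is kept general because the rule for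
    \<open>s o\<^sub>L T\<close> moves one factor \<open>s\<close> into it.\<close>
  have "0 \<le> inner (?p k (T v) - s (?p k (T v))) v" for k
    using T
  proof (induction arbitrary: k)
    case one
    then show ?case using base by simp
  next
    case (mult T)
    then show ?case using mult.IH [of "Suc k"] by (simp add: funpow_swap1)
  next
    case (add T U)
    have "inner (?p k ((T + U) v) - s (?p k ((T + U) v))) v =
        inner (?p k (T v) - s (?p k (T v))) v + inner (?p k (U v) - s (?p k (U v))) v"
      by (simp add: p_add blinfun.add_left blinfun.add_right inner_diff_left inner_add_left)
    then show ?case
      using add.IH(1) [of k] add.IH(2) [of k] by linarith
  next
    case (scale T r)
    have "inner (?p k ((r *\<^sub>R T) v) - s (?p k ((r *\<^sub>R T) v))) v = r * inner (?p k (T v) - s (?p k (T v))) v"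
      by (simp add: p_scale blinfun.scaleR_left blinfun.scaleR_right inner_simps algebra_simps)
    then show ?case
      using scale.IH [of k] scale.hyps by simp
  qed
  from this [of 0] show ?thesis by simp
qed

context vna
begin

text \<open>
  With \<open>s\<^sub>n = 1 - x\<^sub>n\<^sup>* x\<^sub>n\<close> the iteration reads \<open>x\<^sub>n\<^sub>+\<^sub>1 = x\<^sub>n (1 + s\<^sub>n / 2)\<close> and gives
  \<open>s\<^sub>n\<^sub>+\<^sub>1 = (3 s\<^sub>n\<^sup>2 + s\<^sub>n\<^sup>3) / 4\<close>. All coefficients being nonnegative, \<open>x\<^sub>m = x\<^sub>n G\<close> for \<open>m \<ge> n\<close>, where \<open>G - 1\<close> is a
  polynomial in \<open>s\<^sub>n\<close> with nonnegative coefficients; this monotonicity yields strong convergence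
  to the partial isometry of the polar decomposition.
\<close>

primrec newton :: "('h \<Rightarrow>\<^sub>L 'h) \<Rightarrow> nat \<Rightarrow> 'h \<Rightarrow>\<^sub>L 'h" where
  "newton x 0 = x"
| "newton x (Suc n) =
     newton x n o\<^sub>L (id_blinfun + (1/2) *\<^sub>R (id_blinfun - (adj (newton x n) o\<^sub>L newton x n)))"

definition defect :: "('h \<Rightarrow>\<^sub>L 'h) \<Rightarrow> nat \<Rightarrow> 'h \<Rightarrow>\<^sub>L 'h" where
  "defect x n = id_blinfun - (adj (newton x n) o\<^sub>L newton x n)"

lemma newton_in [simp]: "x \<in> M \<Longrightarrow> newton x n \<in> M"
  by (induction n) simp_all

lemma defect_in [simp]: "x \<in> M \<Longrightarrow> defect x n \<in> M"
  by (simp add: defect_def)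

lemma adj_defect: "x \<in> M \<Longrightarrow> adj (defect x n) = defect x n"
  by (simp add: defect_def)

lemma defect_sym:
  assumes "x \<in> M" shows "inner (defect x n v) w = inner v (defect x n w)"
  using inner_adj_left [of "defect x n" v w] assms by (simp add: adj_defect)

lemma inner_newton:
  assumes "x \<in> M" shows "inner (newton x n v) (newton x n w) = inner (v - defect x n v) w"
  using assms by (simp add: defect_def blinfun.diff_left inner_adj_left)

lemma inner_defect:
  assumes "x \<in> M" shows "inner (defect x n v) v = (norm v)\<^sup>2 - (norm (newton x n v))\<^sup>2"
  using inner_newton [OF assms, of n v v] by (simp add: power2_norm_eq_inner inner_diff_left)

text \<open>With \<open>s\<close> the current defect, the new product of adjoint and operator is
  \<open>(1 + s/2) (1 - s) (1 + s/2)\<close>, and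
  \<open>1 - (1 - s) (1 + s/2)^2 = (3 s^2 + s^3) / 4\<close>. The constant 1/2 in the iteration is
  the one that cancels the term linear in \<open>s\<close>.\<close>

lemma defect_Suc:
  assumes x: "x \<in> M"
  shows "defect x (Suc n) = (3/4) *\<^sub>R (defect x n o\<^sub>L defect x n) +
    (1/4) *\<^sub>R (defect x n o\<^sub>L (defect x n o\<^sub>L defect x n))"
proof (rule blinfun_eqI [OF inner_eq_imp_eq])
  fix v w
  let ?s = "defect x n" and ?c = "id_blinfun + (1/2) *\<^sub>R defect x n"
  have S: "newton x (Suc n) = newton x n o\<^sub>L ?c"
    by (simp add: defect_def)
  have *: "inner (newton x (Suc n) w) (newton x (Suc n) v) = inner (?c w - ?s (?c w)) (?c v)"
    by (simp only: S blinfun_apply_blinfun_compose inner_newton [OF x])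
  have "inner w (defect x (Suc n) v) = inner w v - inner (newton x (Suc n) w) (newton x (Suc n) v)"
    using inner_newton [OF x, of "Suc n" w v] by (simp add: inner_diff_left defect_sym [OF x])
  also have "\<dots> = inner w (((3/4) *\<^sub>R (?s o\<^sub>L ?s) + (1/4) *\<^sub>R (?s o\<^sub>L (?s o\<^sub>L ?s))) v)"
    by (simp only: *)
      (simp add: blinfun.bilinear_simps inner_simps defect_sym [OF x] field_simps)
  finally show "inner w (defect x (Suc n) v) = \<dots>" .
qed

text \<open>Contractivity of an iterate is positivity of its defect. The recursion passes it on: one
  term of the new quadratic form is a multiple of a squared norm, the other a multiple of the old
  form at \<open>defect x n v\<close>.\<close>

lemma norm_newton_le:
  assumes x: "x \<in> M" and le: "\<And>v. norm (x v) \<le> norm v"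
  shows "norm (newton x n v) \<le> norm v"
proof -
  have "0 \<le> inner (defect x n v) v" for v
  proof (induction n arbitrary: v)
    case 0
    then show ?case
      using le [of v] by (simp add: inner_defect [OF x] power_mono)
  next
    case (Suc n)
    have "inner (defect x (Suc n) v) v =
        (3/4) * (norm (defect x n v))\<^sup>2 + (1/4) * inner (defect x n (defect x n v)) (defect x n v)"
      by (simp add: defect_Suc [OF x] blinfun.bilinear_simps inner_simps power2_norm_eq_inner
          defect_sym [OF x, of n _ v])
    then show ?case
      using Suc [of "defect x n v"] by simp
  qed
  from this [of v] have "(norm (newton x n v))\<^sup>2 \<le> (norm v)\<^sup>2"
    by (simp add: inner_defect [OF x])
  then show ?thesis
    by (rule power2_le_imp_le) simp
qed

context
  fixes x
  assumes x: "x \<in> M" and le: "\<And>v. norm (x v) \<le> norm v"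
begin

lemma defect_nonneg: "0 \<le> inner (defect x n v) v"
  using norm_newton_le [OF x le, of n v] by (simp add: inner_defect [OF x] power_mono)

lemma defect_le: "inner (defect x n v) v \<le> inner v v"
  by (simp add: inner_defect [OF x] power2_norm_eq_inner [symmetric])

text \<open>That \<open>G - id_blinfun\<close> has nonnegative coefficients is stronger than the
  same for \<open>G\<close>, and is what makes the iterates monotone. The later defect is carried
  along since the next factor is built from it.\<close>

lemma newton_factor:
  "\<exists>G. newton x (n + m) = newton x n o\<^sub>L G \<and> G \<in> nnpoly (defect x n) \<and>
     G - id_blinfun \<in> nnpoly (defect x n) \<and> defect x (n + m) \<in> nnpoly (defect x n)"
proof (induction m)
  case 0
  show ?case
    by (rule exI [of _ id_blinfun]) (auto intro: nnpoly.intros nnpoly_zero nnpoly_self)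
next
  case (Suc m)
  let ?t = "defect x (n + m)"
  from Suc obtain G where G: "newton x (n + m) = newton x n o\<^sub>L G" "G \<in> nnpoly (defect x n)"
    "G - id_blinfun \<in> nnpoly (defect x n)" and t: "?t \<in> nnpoly (defect x n)"
    by blast
  let ?G = "G o\<^sub>L (id_blinfun + (1/2) *\<^sub>R ?t)"
  have 1: "newton x (n + Suc m) = newton x n o\<^sub>L ?G"
    by (rule blinfun_eqI) (simp add: defect_def G(1))
  have "?G - id_blinfun = (G - id_blinfun) + (1/2) *\<^sub>R (G o\<^sub>L ?t)"
    by (rule blinfun_eqI) (simp add: blinfun.bilinear_simps)
  then have 2: "?G - id_blinfun \<in> nnpoly (defect x n)"
    by (simp only:) (intro nnpoly.add nnpoly.scale nnpoly_comp G t, simp)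
  have 3: "?G \<in> nnpoly (defect x n)"
    by (intro nnpoly_comp G nnpoly.intros t) simp
  have "defect x (Suc (n + m)) \<in> nnpoly ?t"
    unfolding defect_Suc [OF x] by (intro nnpoly.intros nnpoly_self) simp_all
  with t have "defect x (n + Suc m) \<in> nnpoly (defect x n)"
    by (simp add: nnpoly_subst)
  with 1 2 3 show ?case by blast
qed

text \<open>The difference of the two sides is the quadratic form of \<open>(1 - s) (G - 1)\<close>
  at \<open>v\<close>, with \<open>s = defect x n\<close>. After expanding a square, the estimate
  bounds the squared distance of two iterates at \<open>v\<close> by the difference of their squared
  norms, so bounded monotone norms give a Cauchy sequence.\<close>

lemma inner_newton_mono:
  "(norm (newton x n v))\<^sup>2 \<le> inner (newton x (n + m) v) (newton x n v)"
proof -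
  obtain G where G: "newton x (n + m) = newton x n o\<^sub>L G"
    and pos: "G - id_blinfun \<in> nnpoly (defect x n)"
    using newton_factor by blast
  have "0 \<le> inner (newton x n ((G - id_blinfun) v)) (newton x n v)"
    unfolding inner_newton [OF x]
    by (rule nnpoly_pos [OF defect_sym [OF x] defect_nonneg defect_le pos])
  then show ?thesis
    by (simp add: G blinfun.bilinear_simps inner_simps power2_norm_eq_inner)
qed

lemma norm_newton_mono: "norm (newton x n v) \<le> norm (newton x (n + m) v)"
proof (cases "newton x n v = 0")
  case False
  have "norm (newton x n v) * norm (newton x n v) \<le> norm (newton x (n + m) v) * norm (newton x n v)"
    using order_trans [OF inner_newton_mono norm_cauchy_schwarz] by (simp add: power2_eq_square)
  then show ?thesis using False by simp
qed simp

lemma Cauchy_newton: "Cauchy (\<lambda>n. newton x n v)"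
proof (rule CauchyI')
  fix e :: real assume e: "0 < e"
  let ?a = "\<lambda>n. (norm (newton x n v))\<^sup>2"
  have "incseq ?a"
    by (intro incseq_SucI power_mono) (use norm_newton_mono [of _ v 1] in auto)
  moreover have "?a n \<le> (norm v)\<^sup>2" for n
    by (intro power_mono norm_newton_le [OF x le]) auto
  ultimately obtain L where "?a \<longlonglongrightarrow> L"
    using incseq_convergent [of ?a "(norm v)\<^sup>2"] by blast
  then have "Cauchy ?a"
    by (rule LIMSEQ_imp_Cauchy)
  then obtain N where N: "\<And>m n. m \<ge> N \<Longrightarrow> n \<ge> N \<Longrightarrow> dist (?a m) (?a n) < e\<^sup>2"
    using e unfolding Cauchy_def by (metis zero_less_power)
  have "norm (newton x m v - newton x n v) < e" if "N \<le> m" "m < n" for m n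
  proof -
    have "(norm (newton x m v - newton x n v))\<^sup>2 \<le> ?a n - ?a m"
      using inner_newton_mono [of m v "n - m"] that
      by (simp add: power2_norm_eq_inner inner_simps inner_commute)
    also have "\<dots> < e\<^sup>2"
      using N [of n m] that by (simp add: dist_real_def)
    finally show ?thesis
      using e by (simp add: power_less_imp_less_base)
  qed
  then show "\<exists>N. \<forall>m\<ge>N. \<forall>n>m. dist (newton x m v) (newton x n v) < e"
    unfolding dist_norm by blast
qed

lemma newton_limit:
  obtains u where "u \<in> M" "\<And>v. (\<lambda>n. newton x n v) \<longlonglongrightarrow> blinfun_apply u v"
    and "(adj u o\<^sub>L u) o\<^sub>L (adj u o\<^sub>L u) = adj u o\<^sub>L u"
proof -
  have "norm (newton x n) \<le> 1" for n
    by (rule norm_blinfun_bound) (simp_all add: norm_newton_le [OF x le])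
  moreover have "\<exists>w. (\<lambda>n. newton x n v) \<longlonglongrightarrow> w" for v
    using Cauchy_newton by (simp add: Cauchy_convergent_iff convergent_def)
  ultimately obtain u where u: "u \<in> M" and lim: "\<And>v. (\<lambda>n. newton x n v) \<longlonglongrightarrow> blinfun_apply u v"
    using strong_limit [of sequentially "newton x" 1] x newton_in sequentially_bot by blast
  define S where "S = id_blinfun - (adj u o\<^sub>L u)"
  have S_in: "S \<in> M" and S_adj: "adj S = S"
    using u by (simp_all add: S_def)
  have S_sym: "inner (S v) w = inner v (S w)" for v w
    using inner_adj_left [OF S_in, of v w] by (simp add: S_adj)
  have inner_S: "inner (S v) v = (norm v)\<^sup>2 - (norm (u v))\<^sup>2" for v
    using u by (simp add: S_def blinfun.bilinear_simps inner_simps inner_adj_left power2_norm_eq_inner)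
  have lim_sq: "(\<lambda>n. (norm (newton x n v))\<^sup>2) \<longlonglongrightarrow> (norm (u v))\<^sup>2" for v
    by (intro tendsto_intros lim)
  have upper: "(norm (newton x n v))\<^sup>2 \<le> (norm (u v))\<^sup>2" for n v
    by (rule incseq_le [OF _ lim_sq], intro incseq_SucI power_mono)
      (use norm_newton_mono [of _ v 1] in auto)
  have S_nonneg: "0 \<le> inner (S v) v" for v
    unfolding inner_S using LIMSEQ_le_const2 [OF lim_sq [of v], of "(norm v)\<^sup>2"]
    by (auto intro!: power_mono norm_newton_le [OF x le])
  have S_le: "inner (S v) v \<le> inner v v" for v
    by (simp add: inner_S power2_norm_eq_inner [symmetric])
  \<comment> \<open>Strong convergence of the iterates does not by itself give convergence of their
    adjoints. Instead, \<open>defect x n - S\<close> is a positive contraction by monotonicity, so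
    its squared norm at \<open>v\<close> is at most its quadratic form, which tends to 0.\<close>
  have defect_lim: "(\<lambda>n. defect x n v) \<longlonglongrightarrow> S v" for v
  proof -
    have "(norm ((defect x n - S) v))\<^sup>2 \<le> inner ((defect x n - S) v) v" for n
    proof (rule positive_contraction_sq_le)
      show "inner ((defect x n - S) v) w = inner v ((defect x n - S) w)" for v w
        by (simp add: blinfun.bilinear_simps inner_simps defect_sym [OF x] S_sym)
      show "0 \<le> inner ((defect x n - S) v) v" for v
        using upper [of n v] by (simp add: blinfun.bilinear_simps inner_simps inner_defect [OF x] inner_S)
      show "inner ((defect x n - S) v) v \<le> inner v v" for v
        using defect_le [of n v] S_nonneg [of v] by (simp add: blinfun.bilinear_simps inner_simps)
    qed
    then have ineq: "(norm (defect x n v - S v))\<^sup>2 \<le> (norm (u v))\<^sup>2 - (norm (newton x n v))\<^sup>2" for n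
      by (simp add: blinfun.bilinear_simps inner_simps inner_defect [OF x] inner_S)
    have lim0: "(\<lambda>n. (norm (u v))\<^sup>2 - (norm (newton x n v))\<^sup>2) \<longlonglongrightarrow> 0"
      by (rule tendsto_eq_rhs [OF tendsto_diff [OF tendsto_const lim_sq]]) simp
    have "(\<lambda>n. (norm (defect x n v - S v))\<^sup>2) \<longlonglongrightarrow> 0"
      by (rule Lim_null_comparison [OF _ lim0]) (simp add: ineq)
    from tendsto_real_sqrt [OF this] have "(\<lambda>n. norm (defect x n v - S v)) \<longlonglongrightarrow> 0"
      by simp
    then show ?thesis
      by (rule LIM_zero_cancel [OF tendsto_norm_zero_cancel])
  qed
  have norm_S: "(norm (S v))\<^sup>2 = inner (S v) v" for v
  proof (rule antisym)
    show "(norm (S v))\<^sup>2 \<le> inner (S v) v"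
      by (rule positive_contraction_sq_le [OF S_sym S_nonneg S_le])
    \<comment> \<open>From \<open>(3 s^2 + s^3) / 4 \<le> s^2\<close>, as \<open>s \<le> 1\<close>.
      In the limit this gives \<open>S \<le> S^2\<close>, opposite to the inequality for positive
      contractions.\<close>
    have "inner (defect x (Suc n) v) v \<le> (norm (defect x n v))\<^sup>2" for n
      using defect_le [of n "defect x n v"]
      by (simp add: defect_Suc [OF x] blinfun.bilinear_simps inner_simps power2_norm_eq_inner
          defect_sym [OF x, of n _ v])
    then show "inner (S v) v \<le> (norm (S v))\<^sup>2"
      by (intro LIMSEQ_le [OF LIMSEQ_Suc [OF tendsto_inner [OF defect_lim tendsto_const]]
          tendsto_power [OF tendsto_norm [OF defect_lim]]]) auto
  qed
  \<comment> \<open>\<open>S - S^2\<close> has vanishing quadratic form. It is symmetric, so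
    \<open>positive_contraction_sq_le\<close> applies to it once more and shows that it is
    zero.\<close>
  have S_zero: "inner ((S - (S o\<^sub>L S)) v) v = 0" for v
    using norm_S [of v]
    by (simp add: blinfun.bilinear_simps inner_simps S_sym [of _ v] power2_norm_eq_inner)
  have "(norm ((S - (S o\<^sub>L S)) v))\<^sup>2 \<le> inner ((S - (S o\<^sub>L S)) v) v" for v
    by (rule positive_contraction_sq_le)
      (simp_all add: S_zero, simp add: blinfun.bilinear_simps inner_simps S_sym)
  then have SS: "S (S v) = S v" for v
    using S_zero by (simp add: blinfun.bilinear_simps)
  have eq: "adj u (u v) = v - S v" for v
    by (simp add: S_def blinfun.bilinear_simps)
  have "(adj u o\<^sub>L u) o\<^sub>L (adj u o\<^sub>L u) = adj u o\<^sub>L u"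
    by (rule blinfun_eqI) (simp add: eq blinfun.bilinear_simps SS)
  with u lim show ?thesis
    by (rule that)
qed

end

section \<open>Projections, partial isometries and comparison\<close>

lemma projectionsD:
  assumes "p \<in> projections M"
  shows "p \<in> M" "adj p = p" "p o\<^sub>L p = p" "p (p v) = p v" "inner (p v) w = inner v (p w)"
proof -
  show *: "p \<in> M" "adj p = p" "p o\<^sub>L p = p"
    using assms by (auto simp: projections_def)
  show "p (p v) = p v"
    using arg_cong [OF *(3), of "\<lambda>p. p v"] by simp
  show "inner (p v) w = inner v (p w)"
    using inner_adj_left [OF *(1), of v w] by (simp add: *(2))
qed

lemma projectionsI:
  "p \<in> M \<Longrightarrow> adj p = p \<Longrightarrow> p o\<^sub>L p = p \<Longrightarrow> p \<in> projections M"
  by (simp add: projections_def)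

text \<open>An operator has the same kernel as its adjoint times itself. The vector
  \<open>v - adj u (u v)\<close> is killed by the idempotent \<open>adj u o\<^sub>L u\<close>, hence
  by \<open>u\<close>.\<close>

lemma partial_isometry:
  assumes u: "u \<in> M" and idem: "(adj u o\<^sub>L u) o\<^sub>L (adj u o\<^sub>L u) = adj u o\<^sub>L u"
  shows "u (adj u (u v)) = u v" and "(u o\<^sub>L adj u, adj u o\<^sub>L u) \<in> mvn_rel M"
proof -
  let ?T = "adj u o\<^sub>L u"
  have T: "?T \<in> projections M"
    by (rule projectionsI) (use u idem in simp_all)
  have *: "u (adj u (u v)) = u v" for v
  proof -
    let ?w = "v - ?T v"
    have "inner (u ?w) (u ?w) = inner (?T ?w) ?w"
      using u by (simp add: inner_adj_left)
    also have "?T ?w = 0"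
      using projectionsD(4) [OF T, of v] by (simp add: blinfun.diff_right)
    finally show ?thesis
      by (simp add: blinfun.diff_right)
  qed
  then show "u (adj u (u v)) = u v" .
  have "u o\<^sub>L adj u \<in> projections M"
    by (rule projectionsI, use u in simp, use u in simp, rule blinfun_eqI, simp add: *)
  with T u show "(u o\<^sub>L adj u, ?T) \<in> mvn_rel M"
    by (auto simp: mvn_rel_def)
qed

text \<open>The final and initial projections of the partial isometry in the polar decomposition of
  \<open>a o\<^sub>L x o\<^sub>L b\<close> lie below \<open>a\<close> and below \<open>b\<close>,
  and are equivalent by construction.\<close>

lemma comparison:
  assumes x: "x \<in> M" and a: "a \<in> projections M" and b: "b \<in> projections M"
    and ne: "a o\<^sub>L x o\<^sub>L b \<noteq> 0"
  obtains e f where "(e, f) \<in> mvn_rel M" "e \<noteq> 0" "f \<noteq> 0" "a o\<^sub>L e = e" "b o\<^sub>L f = f"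
proof -
  define y where "y = a o\<^sub>L x o\<^sub>L b"
  \<comment> \<open>Scaling makes the corner a contraction, as the iteration requires.\<close>
  define z where "z = (1 / norm y) *\<^sub>R y"
  have y: "y \<in> M" "y \<noteq> 0"
    using projectionsD(1) [OF a] projectionsD(1) [OF b] x ne by (simp_all add: y_def)
  then have z: "z \<in> M" by (simp add: z_def)
  have z_le: "norm (z v) \<le> norm v" for v
    using norm_blinfun [of y v] y(2) by (simp add: z_def blinfun.scaleR_left divide_simps mult.commute)
  obtain u where u: "u \<in> M" and lim: "\<And>v. (\<lambda>n. newton z n v) \<longlonglongrightarrow> blinfun_apply u v"
    and idem: "(adj u o\<^sub>L u) o\<^sub>L (adj u o\<^sub>L u) = adj u o\<^sub>L u"
    using newton_limit [OF z z_le] by blast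
  have az: "a (z v) = z v" for v
    using projectionsD(4) [OF a] by (simp add: z_def y_def blinfun.bilinear_simps)
  have zb: "z (b v) = z v" for v
    using projectionsD(4) [OF b] by (simp add: z_def y_def blinfun.bilinear_simps)
  \<comment> \<open>Every iterate factors as \<open>z\<close> followed on the right by some
    \<open>G\<close>, so its range stays in that of \<open>a\<close>; this survives the strong
    limit. On the other side, \<open>u\<close> vanishes on the kernel of \<open>z\<close>, which
    contains all \<open>b v - v\<close>.\<close>
  have au: "a (u v) = u v" for v
  proof (rule LIMSEQ_unique [OF _ lim])
    have "a (newton z n v) = newton z n v" for n
      using newton_factor [OF z z_le, of 0 n] az by auto
    then show "(\<lambda>n. newton z n v) \<longlonglongrightarrow> a (u v)"
      using blinfun.tendsto [OF tendsto_const lim, of a v] by simp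
  qed
  have ker: "u v = 0" if "z v = 0" for v
  proof -
    have "newton z n v = 0" for n
      by (induction n) (simp_all add: that blinfun.bilinear_simps)
    then show ?thesis
      using lim [of v] by (simp add: LIMSEQ_const_iff)
  qed
  have ub: "u (b v) = u v" for v
    using ker [of "b v - v"] by (simp add: blinfun.diff_right zb)
  have "z \<noteq> 0"
    using y by (simp add: z_def)
  then obtain v where v: "z v \<noteq> 0"
    by (metis blinfun_eqI zero_blinfun.rep_eq)
  \<comment> \<open>The iteration never decreases norms, so the limit does not vanish where the
    starting point does not.\<close>
  have "norm (z v) \<le> norm (u v)"
    by (rule LIMSEQ_le_const [OF tendsto_norm [OF lim]])
      (use norm_newton_mono [OF z z_le, of 0 v] in auto)
  then have uv: "u v \<noteq> 0"
    using v by auto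
  have pu: "u (adj u (u v)) = u v"
    by (rule partial_isometry(1) [OF u idem])
  show ?thesis
  proof (rule that)
    show "(u o\<^sub>L adj u, adj u o\<^sub>L u) \<in> mvn_rel M"
      by (rule partial_isometry(2) [OF u idem])
    show "u o\<^sub>L adj u \<noteq> 0"
    proof
      assume "u o\<^sub>L adj u = 0"
      then have "(u o\<^sub>L adj u) (u v) = 0" by simp
      with pu uv show False by simp
    qed
    show "adj u o\<^sub>L u \<noteq> 0"
    proof
      assume "adj u o\<^sub>L u = 0"
      then have "(adj u o\<^sub>L u) v = 0" by simp
      with pu uv show False by simp
    qed
    show "a o\<^sub>L (u o\<^sub>L adj u) = u o\<^sub>L adj u"
      by (rule blinfun_eqI) (simp add: au)
    have "(adj u o\<^sub>L u) o\<^sub>L b = adj u o\<^sub>L u"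
      by (rule blinfun_eqI) (simp add: ub)
    then have "adj ((adj u o\<^sub>L u) o\<^sub>L b) = adj (adj u o\<^sub>L u)"
      by simp
    then show "b o\<^sub>L (adj u o\<^sub>L u) = adj u o\<^sub>L u"
      using u projectionsD [OF b] by simp
  qed
qed

end


section \<open>Order, equivalence and orthogonal sums of projections\<close>

text \<open>The index sets will be maximal families and may be uncountable, hence sums over the net
  of finite subsets. By Pythagoras the partial sums are Cauchy together with those of the squared
  norms.\<close>

lemma summable_on_orthogonal:
  fixes x :: "'i \<Rightarrow> 'a::{real_inner, complete_space}"
  assumes orth: "\<And>i j. i \<in> I \<Longrightarrow> j \<in> I \<Longrightarrow> i \<noteq> j \<Longrightarrow> inner (x i) (x j) = 0"
    and bound: "\<And>F. finite F \<Longrightarrow> F \<subseteq> I \<Longrightarrow> (\<Sum>i\<in>F. (norm (x i))\<^sup>2) \<le> C"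
  shows "x summable_on I"
proof -
  let ?N = "\<lambda>F. \<Sum>i\<in>F. (norm (x i))\<^sup>2"
  have pyth: "(norm (sum x F))\<^sup>2 = ?N F" if "finite F" "F \<subseteq> I" for F
    using norm_sum_Pythagorean [of F x] that orth by (auto simp: pairwise_def orthogonal_def subset_iff)
  have "(\<lambda>i. (norm (x i))\<^sup>2) summable_on I"
    by (rule nonneg_bdd_above_summable_on) (auto intro!: bdd_aboveI2 [where M = C] bound)
  then obtain L where lim: "(?N \<longlongrightarrow> L) (finite_subsets_at_top I)"
    unfolding has_sum_def summable_on_def by blast
  have "\<exists>P. eventually P (finite_subsets_at_top I) \<and>
          (\<forall>F F'. P F \<and> P F' \<longrightarrow> dist (sum x F) (sum x F') < e)" if e: "e > 0" for e
  proof -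
    have "\<forall>\<^sub>F F in finite_subsets_at_top I. dist (?N F) L < e\<^sup>2 / 8"
      using lim e by (intro tendstoD) auto
    then have "\<exists>F0. finite F0 \<and> F0 \<subseteq> I \<and>
        (\<forall>F. finite F \<and> F0 \<subseteq> F \<and> F \<subseteq> I \<longrightarrow> dist (?N F) L < e\<^sup>2 / 8)"
      unfolding eventually_finite_subsets_at_top .
    then obtain F0 where F0: "finite F0" "F0 \<subseteq> I"
      and near: "\<And>F. finite F \<Longrightarrow> F0 \<subseteq> F \<Longrightarrow> F \<subseteq> I \<Longrightarrow> dist (?N F) L < e\<^sup>2 / 8"
      by (elim exE conjE) simp
    \<comment> \<open>Two deviations of \<open>e^2 / 8\<close> from \<open>L\<close> bound the
      squared distance by \<open>(e / 2)^2\<close>; the triangle inequality through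
      \<open>F0\<close> then gives \<open>e\<close>.\<close>
    have half: "dist (sum x F) (sum x F0) < e / 2" if F: "finite F" "F0 \<subseteq> F" "F \<subseteq> I" for F
    proof -
      have "(norm (sum x F - sum x F0))\<^sup>2 = ?N (F - F0)"
        using F F0 pyth [of "F - F0"] by (simp add: sum_diff Diff_subset subset_trans [of "F - F0" F I])
      also have "\<dots> = ?N F - ?N F0"
        using F F0 by (simp add: sum_diff)
      also have "\<dots> < e\<^sup>2 / 4"
        using near [OF F] near [OF F0(1) order_refl F0(2)] unfolding dist_real_def by linarith
      also have "\<dots> = (e / 2)\<^sup>2"
        by (simp add: power_divide)
      finally show ?thesis
        unfolding dist_norm by (rule power_less_imp_less_base) (use e in simp)
    qed
    have "dist (sum x F) (sum x F') < e"
      if "finite F \<and> F0 \<subseteq> F \<and> F \<subseteq> I" "finite F' \<and> F0 \<subseteq> F' \<and> F' \<subseteq> I" for F F'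
      using dist_triangle_half_l [of "sum x F" "sum x F0" e "sum x F'"] half [of F] half [of F'] that
      by (simp add: dist_commute)
    moreover have "\<forall>\<^sub>F F in finite_subsets_at_top I. finite F \<and> F0 \<subseteq> F \<and> F \<subseteq> I"
      unfolding eventually_finite_subsets_at_top using F0 by blast
    ultimately show ?thesis
      by (intro exI [of _ "\<lambda>F. finite F \<and> F0 \<subseteq> F \<and> F \<subseteq> I"]) simp
  qed
  then have "cauchy_filter (filtermap (sum x) (finite_subsets_at_top I))"
    by (simp add: cauchy_filter_metric_filtermap)
  moreover have "complete (UNIV :: 'a set)"
    by (meson Cauchy_convergent UNIV_I complete_def convergent_def)
  ultimately obtain L' where "(sum x \<longlongrightarrow> L') (finite_subsets_at_top I)"
    using complete_uniform [where S = UNIV] by (force simp add: filterlim_def)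
  then show ?thesis
    using summable_on_def has_sum_def by blast
qed

lemma has_sum_blinfun_apply:
  "(f has_sum s) I \<Longrightarrow> ((\<lambda>i. blinfun_apply T (f i)) has_sum T s) I"
  using has_sum_bounded_linear [OF blinfun.bounded_linear_right] by blast

lemma sum_blinfun_apply: "blinfun_apply (sum T F) v = (\<Sum>i\<in>F. T i v)"
  by (induction F rule: infinite_finite_induct) (simp_all add: blinfun.add_left)

lemma norm_projection_le:
  assumes "\<And>v w. inner (blinfun_apply p v) w = inner v (p w)" "\<And>v. p (p v) = p v"
  shows "norm (p v) \<le> norm v"
proof (cases "p v = 0")
  case False
  have "norm (p v) * norm (p v) = inner v (p v)"
    using assms(1) [of v "p v"] assms(2) by (simp add: power2_norm_eq_inner flip: power2_eq_square)
  also have "\<dots> \<le> norm v * norm (p v)"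
    by (rule norm_cauchy_schwarz)
  finally show ?thesis
    using False by simp
qed simp

context vna
begin

lemma proj_norm_le: "p \<in> projections M \<Longrightarrow> norm (p v) \<le> norm v"
  by (intro norm_projection_le projectionsD)

lemma proj_norm_sq: "p \<in> projections M \<Longrightarrow> (norm (p v))\<^sup>2 = inner (p v) v"
  by (metis projectionsD(4,5) power2_norm_eq_inner inner_commute)

text \<open>Take adjoints. With \<open>r = 0\<close> this reverses an orthogonality relation, with
  \<open>r\<close> equal to a factor it reverses an order relation.\<close>

lemma proj_comp_swap:
  assumes "p \<in> projections M" "q \<in> projections M" "r \<in> projections M" "p o\<^sub>L q = r"
  shows "q o\<^sub>L p = r"
  using arg_cong [OF assms(4), of adj] assms(1-3) [THEN projectionsD(1)]
    assms(1-3) [THEN projectionsD(2)] by simp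

lemma zero_proj [simp]: "0 \<in> projections M"
  by (rule projectionsI) simp_all

lemma proj_diff:
  assumes p: "p \<in> projections M" and s: "s \<in> projections M" and sp: "s o\<^sub>L p = p"
  shows "s - p \<in> projections M"
proof (rule projectionsI)
  have ps: "p o\<^sub>L s = p"
    using proj_comp_swap [OF s p p sp] .
  have "p (s v) = p v" "s (p v) = p v" for v
    using arg_cong [OF ps, of "\<lambda>t. t v"] arg_cong [OF sp, of "\<lambda>t. t v"] by simp_all
  then show "(s - p) o\<^sub>L (s - p) = s - p"
    by (intro blinfun_eqI) (simp add: blinfun.bilinear_simps projectionsD(4) [OF p] projectionsD(4) [OF s])
qed (use projectionsD [OF p] projectionsD [OF s] in simp_all)

lemma proj_positive:
  assumes "p \<in> projections M" shows "p \<in> positives M"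
proof -
  have "p = p o\<^sub>L adj p"
    using projectionsD [OF assms] by simp
  then show ?thesis
    using projectionsD(1) [OF assms] unfolding positives_def by blast
qed

text \<open>Turns the order into an algebraic identity, which is the form used from here on. If
  \<open>s - p\<close> is positive, testing it at \<open>v - s v\<close> yields minus a squared
  norm, so \<open>p\<close> vanishes there.\<close>

lemma le_op_proj:
  assumes p: "p \<in> projections M" and s: "s \<in> projections M"
  shows "le_op M p s \<longleftrightarrow> s o\<^sub>L p = p"
proof
  assume "s o\<^sub>L p = p"
  then show "le_op M p s"
    unfolding le_op_def by (intro proj_positive proj_diff p s)
next
  assume "le_op M p s"
  then obtain y where y: "y \<in> M" "s - p = y o\<^sub>L adj y"
    unfolding le_op_def positives_def by blast
  have ps: "p v = p (s v)" for v
  proof -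
    let ?w = "v - s v"
    have "0 \<le> inner (adj y ?w) (adj y ?w)"
      by simp
    also have "\<dots> = inner ((s - p) ?w) ?w"
      using y by (simp add: inner_adj_right)
    also have "\<dots> = - (norm (p ?w))\<^sup>2"
      unfolding proj_norm_sq [OF p]
      by (simp add: blinfun.diff_left blinfun.diff_right [of s] projectionsD(4) [OF s])
    finally have "p ?w = 0"
      by simp
    then show ?thesis
      by (simp add: blinfun.diff_right)
  qed
  have "p o\<^sub>L s = p"
    by (rule blinfun_eqI) (simp flip: ps)
  then show "s o\<^sub>L p = p"
    using proj_comp_swap [OF p s p] by simp
qed

lemma proj_antisym:
  assumes "p \<in> projections M" "s \<in> projections M" "s o\<^sub>L p = p" "p o\<^sub>L s = s"
  shows "p = s"
  using proj_comp_swap [OF assms(2) assms(1) assms(1) assms(3)] assms(4) by simp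

section \<open>Murray-von Neumann equivalence and its classes\<close>

lemma mvn_relI:
  "\<lbrakk>p \<in> projections M; q \<in> projections M; u \<in> M; p = u o\<^sub>L adj u; q = adj u o\<^sub>L u\<rbrakk>
    \<Longrightarrow> (p, q) \<in> mvn_rel M"
  unfolding mvn_rel_def by blast

lemma mvn_refl: "p \<in> projections M \<Longrightarrow> (p, p) \<in> mvn_rel M"
  unfolding mvn_rel_def by (auto simp: projectionsD intro!: bexI [of _ p])

lemma mvn_sym:
  assumes "(p, q) \<in> mvn_rel M"
  shows "(q, p) \<in> mvn_rel M"
proof -
  obtain u where "u \<in> M" "p = u o\<^sub>L adj u" "q = adj u o\<^sub>L u"
    using assms unfolding mvn_rel_def by blast
  then have "adj u \<in> M" "q = adj u o\<^sub>L adj (adj u)" "p = adj (adj u) o\<^sub>L adj u"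
    by simp_all
  with assms show ?thesis
    unfolding mvn_rel_def by blast
qed

lemma mvn_proj: "(p, q) \<in> mvn_rel M \<Longrightarrow> p \<in> projections M \<and> q \<in> projections M"
  unfolding mvn_rel_def by auto

lemma blinfun_compose_assoc: "(a o\<^sub>L b) o\<^sub>L c = a o\<^sub>L (b o\<^sub>L (c :: 'h \<Rightarrow>\<^sub>L 'h))"
  by (rule blinfun_eqI) simp

lemma mvn_trans:
  assumes "(p, q) \<in> mvn_rel M" "(q, r) \<in> mvn_rel M"
  shows "(p, r) \<in> mvn_rel M"
proof -
  obtain u where u: "u \<in> M" "p = u o\<^sub>L adj u" "q = adj u o\<^sub>L u"
    using assms(1) unfolding mvn_rel_def by blast
  obtain v where v: "v \<in> M" "q = v o\<^sub>L adj v" "r = adj v o\<^sub>L v"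
    using assms(2) unfolding mvn_rel_def by blast
  have p: "p o\<^sub>L p = p" and r: "r o\<^sub>L r = r"
    using assms by (auto dest: mvn_proj projectionsD(3))
  have "(u o\<^sub>L v) o\<^sub>L adj (u o\<^sub>L v) = u o\<^sub>L (v o\<^sub>L adj v) o\<^sub>L adj u"
    using u(1) v(1) by (simp add: blinfun_compose_assoc)
  also have "\<dots> = p o\<^sub>L p"
    unfolding v(2) [symmetric] by (simp add: u(2,3) blinfun_compose_assoc)
  finally have 1: "p = (u o\<^sub>L v) o\<^sub>L adj (u o\<^sub>L v)"
    using p by simp
  have "adj (u o\<^sub>L v) o\<^sub>L (u o\<^sub>L v) = adj v o\<^sub>L (adj u o\<^sub>L u) o\<^sub>L v"
    using u(1) v(1) by (simp add: blinfun_compose_assoc)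
  also have "\<dots> = r o\<^sub>L r"
    unfolding u(3) [symmetric] by (simp add: v(2,3) blinfun_compose_assoc)
  finally have 2: "r = adj (u o\<^sub>L v) o\<^sub>L (u o\<^sub>L v)"
    using r by simp
  show ?thesis
    using assms by (intro mvn_relI [OF _ _ _ 1 2]) (auto dest: mvn_proj simp: u(1) v(1))
qed

lemma equiv_mvn: "equiv (projections M) (mvn_rel M)"
proof (rule equivI)
  show "mvn_rel M \<subseteq> projections M \<times> projections M"
    by (auto dest: mvn_proj)
  show "refl_on (projections M) (mvn_rel M)"
    by (simp add: refl_on_def mvn_refl)
  show "sym (mvn_rel M)"
    by (rule symI) (rule mvn_sym)
  show "trans (mvn_rel M)"
    by (rule transI) (rule mvn_trans)
qed

lemma mvn_class_eq_iff:
  "p \<in> projections M \<Longrightarrow> q \<in> projections M \<Longrightarrow> mvn_class M p = mvn_class M q \<longleftrightarrow> (p, q) \<in> mvn_rel M"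
  unfolding mvn_class_def by (rule eq_equiv_class_iff [OF equiv_mvn])

lemma mem_mvn_class: "q \<in> mvn_class M p \<longleftrightarrow> (p, q) \<in> mvn_rel M"
  by (simp add: mvn_class_def)

lemma mvn_class_in_classes: "p \<in> projections M \<Longrightarrow> mvn_class M p \<in> mvn_classes M"
  unfolding mvn_class_def mvn_classes_def by (rule quotientI)

lemma mvn_classesD:
  assumes "c \<in> mvn_classes M" "p \<in> c"
  shows "p \<in> projections M" "c = mvn_class M p"
proof -
  obtain q where q: "q \<in> projections M" "c = mvn_class M q"
    using assms(1) unfolding mvn_classes_def mvn_class_def by (rule quotientE)
  with assms(2) have "(q, p) \<in> mvn_rel M"
    by (simp add: mem_mvn_class)
  then show p: "p \<in> projections M" and "c = mvn_class M p"
    using q mvn_class_eq_iff mvn_proj by blast+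
qed

definition orthogonal_projections :: "'i set \<Rightarrow> ('i \<Rightarrow> 'h \<Rightarrow>\<^sub>L 'h) \<Rightarrow> bool" where
  "orthogonal_projections I e \<longleftrightarrow> (\<forall>i\<in>I. e i \<in> projections M) \<and>
     (\<forall>i\<in>I. \<forall>j\<in>I. i \<noteq> j \<longrightarrow> e i o\<^sub>L e j = 0)"

text \<open>Pointwise, that is strong, convergence: the norm topology is too fine for a sum of
  infinitely many nonzero orthogonal projections. The summands need not be projections, as partial
  isometries are summed too.\<close>

definition strong_sum :: "'i set \<Rightarrow> ('i \<Rightarrow> 'h \<Rightarrow>\<^sub>L 'h) \<Rightarrow> ('h \<Rightarrow>\<^sub>L 'h) \<Rightarrow> bool" where
  "strong_sum I e E \<longleftrightarrow> E \<in> M \<and> (\<forall>v. ((\<lambda>i. e i v) has_sum E v) I)"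

lemma strong_sumD: "strong_sum I e E \<Longrightarrow> ((\<lambda>i. e i v) has_sum E v) I"
  by (simp add: strong_sum_def)

lemma orthogonal_projectionsD:
  assumes "orthogonal_projections I e" "i \<in> I"
  shows "e i \<in> projections M" "j \<in> I \<Longrightarrow> i \<noteq> j \<Longrightarrow> e i o\<^sub>L e j = 0"
  using assms unfolding orthogonal_projections_def by blast+

lemma sum_orthogonal_projections:
  assumes e: "orthogonal_projections I e" and F: "finite F" "F \<subseteq> I"
  shows "sum e F \<in> projections M"
  using F
proof (induction F)
  case (insert i F)
  have i: "e i \<in> projections M" "sum e F \<in> projections M"
    using e insert by (auto simp: orthogonal_projections_def)
  have "e i (e j v) = 0" if "j \<in> F" for j v
  proof -
    have "e i o\<^sub>L e j = 0"
      by (rule orthogonal_projectionsD(2) [OF e]) (use insert that in auto)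
    from arg_cong [OF this, of "\<lambda>t. t v"] show ?thesis by simp
  qed
  then have a: "e i o\<^sub>L sum e F = 0"
    by (intro blinfun_eqI) (simp add: sum_blinfun_apply blinfun.sum_right)
  have b: "sum e F o\<^sub>L e i = 0"
    using proj_comp_swap [OF i zero_proj a] .
  show ?case
  proof (rule projectionsI)
    have "e i (sum e F v) = 0" "sum e F (e i v) = 0" for v
      using arg_cong [OF a, of "\<lambda>t. t v"] arg_cong [OF b, of "\<lambda>t. t v"] by simp_all
    then show "sum e (insert i F) o\<^sub>L sum e (insert i F) = sum e (insert i F)"
      using insert by (intro blinfun_eqI)
        (simp add: blinfun.add_left blinfun.add_right projectionsD(4) [OF i(1)] projectionsD(4) [OF i(2)])
  qed (use insert projectionsD [OF i(1)] projectionsD [OF i(2)] in simp_all)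
qed simp

text \<open>Orthogonal ranges make the vectors \<open>u i v\<close> pairwise orthogonal; orthogonal
  initial projections bound the sum of their squared norms by that of \<open>v\<close>. Hence the
  partial sums are contractions and converge pointwise.\<close>

lemma strong_sum_partial_isometries:
  assumes u: "\<And>i. i \<in> I \<Longrightarrow> u i \<in> M"
    and e: "orthogonal_projections I (\<lambda>i. u i o\<^sub>L adj (u i))"
    and f: "orthogonal_projections I (\<lambda>i. adj (u i) o\<^sub>L u i)"
  shows "\<exists>U. strong_sum I u U"
proof -
  have idem: "(adj (u i) o\<^sub>L u i) o\<^sub>L (adj (u i) o\<^sub>L u i) = adj (u i) o\<^sub>L u i" if "i \<in> I" for i
    using f that projectionsD(3) unfolding orthogonal_projections_def by blast
  have pi: "u i (adj (u i) (u i v)) = u i v" if "i \<in> I" for i v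
    by (rule partial_isometry(1) [OF u idem]) (use that in auto)
  have orth: "inner (u i v) (u j w) = 0" if ij: "i \<in> I" "j \<in> I" "i \<noteq> j" for i j v w
  proof -
    have ei: "u i o\<^sub>L adj (u i) \<in> projections M"
      using e ij unfolding orthogonal_projections_def by blast
    have "(u i o\<^sub>L adj (u i)) o\<^sub>L (u j o\<^sub>L adj (u j)) = 0"
      using e ij unfolding orthogonal_projections_def by blast
    from arg_cong [OF this, of "\<lambda>t. t (u j w)"]
    have 0: "(u i o\<^sub>L adj (u i)) (u j w) = 0"
      by (simp add: pi ij)
    have "inner (u i v) (u j w) = inner ((u i o\<^sub>L adj (u i)) (u i v)) (u j w)"
      by (simp add: pi ij)
    also have "\<dots> = inner (u i v) ((u i o\<^sub>L adj (u i)) (u j w))"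
      by (rule projectionsD(5) [OF ei])
    finally show ?thesis
      by (simp only: 0 inner_zero_right)
  qed
  have norm_sum: "(\<Sum>i\<in>F. (norm (u i v))\<^sup>2) \<le> (norm v)\<^sup>2" if F: "finite F" "F \<subseteq> I" for F v
  proof -
    let ?f = "\<Sum>i\<in>F. adj (u i) o\<^sub>L u i"
    have fp: "?f \<in> projections M"
      by (rule sum_orthogonal_projections [OF f F])
    have "(\<Sum>i\<in>F. (norm (u i v))\<^sup>2) = inner (?f v) v"
      using F u by (simp add: sum_blinfun_apply inner_sum_left power2_norm_eq_inner inner_adj_left subset_iff)
    also have "\<dots> = (norm (?f v))\<^sup>2"
      by (rule proj_norm_sq [OF fp, symmetric])
    also have "\<dots> \<le> (norm v)\<^sup>2"
      by (intro power_mono proj_norm_le [OF fp]) simp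
    finally show ?thesis .
  qed
  \<comment> \<open>The value 0 off the finite subsets of \<open>I\<close> makes membership in
    \<open>M\<close> and the norm bound hold at every index, as \<open>strong_limit\<close> demands;
    it does not affect the limit.\<close>
  define T where "T F = (if finite F \<and> F \<subseteq> I then sum u F else 0)" for F
  have T_in: "T F \<in> M" for F
    using u by (auto simp: T_def subset_iff)
  have T_norm: "norm (T F) \<le> 1" for F
  proof (cases "finite F \<and> F \<subseteq> I")
    case True
    show ?thesis
    proof (rule norm_blinfun_bound)
      fix v
      have "(norm (sum u F v))\<^sup>2 = (\<Sum>i\<in>F. (norm (u i v))\<^sup>2)"
        unfolding sum_blinfun_apply
        using norm_sum_Pythagorean [of F "\<lambda>i. u i v"] True orth
        by (auto simp: pairwise_def orthogonal_def subset_iff)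
      also have "\<dots> \<le> (norm v)\<^sup>2"
        using norm_sum True by blast
      finally have "norm (sum u F v) \<le> norm v"
        by (rule power2_le_imp_le) simp
      then show "norm (T F v) \<le> 1 * norm v"
        using True by (simp add: T_def)
    qed simp
  qed (auto simp: T_def)
  have ev: "\<forall>\<^sub>F F in finite_subsets_at_top I. (\<Sum>i\<in>F. u i v) = T F v" for v
    by (rule eventually_finite_subsets_at_top_weakI) (simp add: T_def sum_blinfun_apply)
  have conv: "\<exists>w. ((\<lambda>F. T F v) \<longlongrightarrow> w) (finite_subsets_at_top I)" for v
  proof -
    have "(\<lambda>i. u i v) summable_on I"
      by (rule summable_on_orthogonal [OF orth norm_sum])
    then obtain w where "((\<lambda>F. \<Sum>i\<in>F. u i v) \<longlongrightarrow> w) (finite_subsets_at_top I)"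
      unfolding summable_on_def has_sum_def by blast
    then have "((\<lambda>F. T F v) \<longlongrightarrow> w) (finite_subsets_at_top I)"
      by (rule Lim_transform_eventually [OF _ ev])
    then show ?thesis by blast
  qed
  have "\<exists>U\<in>M. \<forall>v. ((\<lambda>F. T F v) \<longlongrightarrow> U v) (finite_subsets_at_top I)"
    by (rule strong_limit [OF finite_subsets_at_top_neq_bot T_in T_norm conv])
  then obtain U where U: "U \<in> M" "\<And>v. ((\<lambda>F. T F v) \<longlongrightarrow> U v) (finite_subsets_at_top I)"
    by blast
  have "((\<lambda>i. u i v) has_sum U v) I" for v
    unfolding has_sum_def
    by (rule Lim_transform_eventually [OF U(2)], rule eventually_mono [OF ev [of v]]) simp
  with U(1) show ?thesis
    unfolding strong_sum_def by blast
qed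

text \<open>Taking adjoints is not strongly continuous, so the convergence of the adjoint series is
  a separate hypothesis; the two sums are then compared through inner products.\<close>

lemma strong_sum_adj:
  assumes u: "\<And>i. i \<in> I \<Longrightarrow> u i \<in> M" and U: "strong_sum I u U" and V: "strong_sum I (\<lambda>i. adj (u i)) V"
  shows "adj U = V"
proof (rule adjI)
  show "U \<in> M"
    using U by (simp add: strong_sum_def)
  fix x y
  have "((\<lambda>i. inner (u i x) y) has_sum inner (U x) y) I"
    by (rule has_sum_bounded_linear [OF bounded_linear_inner_left strong_sumD [OF U]])
  moreover have "((\<lambda>i. inner x (adj (u i) y)) has_sum inner x (V y)) I"
    by (rule has_sum_bounded_linear [OF bounded_linear_inner_right strong_sumD [OF V]])
  moreover have "((\<lambda>i. inner x (adj (u i) y)) has_sum inner x (V y)) I \<longleftrightarrow>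
      ((\<lambda>i. inner (u i x) y) has_sum inner x (V y)) I"
    by (rule has_sum_cong) (simp add: inner_adj_right u)
  ultimately show "inner (U x) y = inner x (V y)"
    using has_sum_unique by blast
qed

lemma has_sum_single:
  fixes f :: "'i \<Rightarrow> 'a::topological_comm_monoid_add"
  assumes "i \<in> I" "\<And>j. j \<in> I \<Longrightarrow> j \<noteq> i \<Longrightarrow> f j = 0"
  shows "(f has_sum f i) I"
  using has_sum_finite_neutralI [of "{i}" I f "f i"] assms by auto

lemma strong_sum_projection:
  assumes e: "orthogonal_projections I e"
  obtains E where "E \<in> projections M" "strong_sum I e E"
proof -
  have ei: "e i \<in> projections M" "e i o\<^sub>L adj (e i) = e i" "e i o\<^sub>L e i = e i" "adj (e i) = e i"
    if "i \<in> I" for i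
    using orthogonal_projectionsD(1) [OF e that] by (auto simp: projectionsD)
  have 1: "orthogonal_projections I (\<lambda>i. e i o\<^sub>L adj (e i))"
    and 2: "orthogonal_projections I (\<lambda>i. adj (e i) o\<^sub>L e i)"
    using e by (auto simp: orthogonal_projections_def ei)
  have e_in: "e i \<in> M" if "i \<in> I" for i
    using projectionsD(1) [OF ei(1) [OF that]] .
  obtain E where E: "strong_sum I e E"
    using strong_sum_partial_isometries [OF e_in 1 2] by blast
  have "((\<lambda>i. adj (e i) v) has_sum E v) I" for v
    using strong_sumD [OF E, of v] has_sum_cong [of I "\<lambda>i. adj (e i) v" "\<lambda>i. e i v"] ei(4) by auto
  then have "strong_sum I (\<lambda>i. adj (e i)) E"
    using E by (simp add: strong_sum_def)
  from strong_sum_adj [OF e_in E this] have adj: "adj E = E" .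
  have eE: "e i (E v) = e i v" if i: "i \<in> I" for i v
  proof (rule has_sum_unique)
    show "((\<lambda>j. e i (e j v)) has_sum e i (E v)) I"
      by (rule has_sum_blinfun_apply [OF strong_sumD [OF E]])
    have "e i (e j v) = 0" if "j \<in> I" "j \<noteq> i" for j
      using arg_cong [OF orthogonal_projectionsD(2) [OF e i, of j], of "\<lambda>t. t v"] that by simp
    then have "((\<lambda>j. e i (e j v)) has_sum e i (e i v)) I"
      using has_sum_single [OF i, of "\<lambda>j. e i (e j v)"] by blast
    then show "((\<lambda>j. e i (e j v)) has_sum e i v) I"
      by (simp add: projectionsD(4) [OF ei(1) [OF i]])
  qed
  have "E (E v) = E v" for v
  proof (rule has_sum_unique)
    show "((\<lambda>i. e i (E v)) has_sum E (E v)) I"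
      by (rule strong_sumD [OF E])
    show "((\<lambda>i. e i (E v)) has_sum E v) I"
      using strong_sumD [OF E, of v] has_sum_cong [of I "\<lambda>i. e i (E v)" "\<lambda>i. e i v"] eE by auto
  qed
  then have "E o\<^sub>L E = E"
    by (intro blinfun_eqI) simp
  moreover have "E \<in> M"
    using E by (simp add: strong_sum_def)
  ultimately show ?thesis
    using adj E by (intro that projectionsI)
qed

lemma strong_sum_ge:
  assumes e: "orthogonal_projections I e" and E: "strong_sum I e E" and i: "i \<in> I"
  shows "E o\<^sub>L e i = e i"
proof (rule blinfun_eqI, simp)
  fix v
  have ei: "e i \<in> projections M"
    by (rule orthogonal_projectionsD(1) [OF e i])
  show "E (e i v) = e i v"
  proof (rule has_sum_unique [OF strong_sumD [OF E]])
    have "e j (e i v) = 0" if "j \<in> I" "j \<noteq> i" for j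
      using arg_cong [OF orthogonal_projectionsD(2) [OF e, of j i], of "\<lambda>t. t v"] that i by simp
    then have "((\<lambda>j. e j (e i v)) has_sum e i (e i v)) I"
      using has_sum_single [OF i, of "\<lambda>j. e j (e i v)"] by blast
    then show "((\<lambda>j. e j (e i v)) has_sum e i v) I"
      by (simp add: projectionsD(4) [OF ei])
  qed
qed

lemma strong_sum_comp_eq:
  assumes E: "strong_sum I e E" and r: "\<And>i. i \<in> I \<Longrightarrow> r o\<^sub>L e i = t o\<^sub>L e i"
  shows "r o\<^sub>L E = t o\<^sub>L E"
proof (rule blinfun_eqI, simp)
  fix v
  have "((\<lambda>i. r (e i v)) has_sum r (E v)) I" "((\<lambda>i. t (e i v)) has_sum t (E v)) I"
    by (intro has_sum_blinfun_apply strong_sumD [OF E])+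
  moreover have "r (e i v) = t (e i v)" if "i \<in> I" for i
    using arg_cong [OF r [OF that], of "\<lambda>t. t v"] by simp
  ultimately show "r (E v) = t (E v)"
    using has_sum_cong [of I "\<lambda>i. r (e i v)" "\<lambda>i. t (e i v)"] has_sum_unique by blast
qed

lemma strong_sum_least:
  assumes "strong_sum I e E" "\<And>i. i \<in> I \<Longrightarrow> r o\<^sub>L e i = e i"
  shows "r o\<^sub>L E = E"
  using strong_sum_comp_eq [OF assms(1), of r id_blinfun] assms(2) by simp

lemma strong_sum_comp_zero:
  assumes "strong_sum I e E" "\<And>i. i \<in> I \<Longrightarrow> r o\<^sub>L e i = 0"
  shows "r o\<^sub>L E = 0"
  using strong_sum_comp_eq [OF assms(1), of r 0] assms(2) by simp

text \<open>\<open>class_sum\<close> speaks of joins in the lattice of projections, whereas traces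
  and partial isometries are compatible with sums; this is the bridge.\<close>

lemma is_join_strong_sum_iff:
  assumes e: "orthogonal_projections I e" and E: "E \<in> projections M" "strong_sum I e E"
  shows "is_join M I e s \<longleftrightarrow> s = E"
proof -
  have join_E: "is_join M I e E"
    unfolding is_join_def
  proof (intro conjI ballI impI)
    show "le_op M (e i) E" if "i \<in> I" for i
      using le_op_proj [OF orthogonal_projectionsD(1) [OF e that] E(1)] strong_sum_ge [OF e E(2) that] by simp
    show "le_op M E r" if r: "r \<in> projections M" "\<forall>i\<in>I. le_op M (e i) r" for r
    proof -
      have "r o\<^sub>L e i = e i" if "i \<in> I" for i
        using r that le_op_proj [OF orthogonal_projectionsD(1) [OF e that] r(1)] by simp
      then show ?thesis
        using strong_sum_least [OF E(2)] le_op_proj [OF E(1) r(1)] by simp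
    qed
  qed (rule E(1))
  have "s = E" if "is_join M I e s"
  proof (rule proj_antisym)
    show s: "s \<in> projections M"
      using that by (simp add: is_join_def)
    have "le_op M s E" "le_op M E s"
      using that join_E unfolding is_join_def by blast+
    then show "E o\<^sub>L s = s" "s o\<^sub>L E = E"
      using le_op_proj [OF s E(1)] le_op_proj [OF E(1) s] by simp_all
  qed (rule E(1))
  with join_E show ?thesis by blast
qed

text \<open>The strong sum of partial isometries implementing \<open>e i\<close> and
  \<open>f i\<close> implements the equivalence of the sums. Mixed products vanish:
  \<open>adj (u i)\<close> times \<open>u j\<close> by orthogonality of the \<open>e i\<close>, and
  \<open>u i\<close> times \<open>adj (u j)\<close> by that of the \<open>f i\<close>.\<close>

lemma mvn_strong_sum:
  assumes e: "orthogonal_projections I e" and f: "orthogonal_projections I f"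
    and E: "E \<in> projections M" "strong_sum I e E" and F: "F \<in> projections M" "strong_sum I f F"
    and ef: "\<And>i. i \<in> I \<Longrightarrow> (e i, f i) \<in> mvn_rel M"
  shows "(E, F) \<in> mvn_rel M"
proof -
  have "\<forall>i\<in>I. \<exists>u. u \<in> M \<and> e i = u o\<^sub>L adj u \<and> f i = adj u o\<^sub>L u"
    using ef unfolding mvn_rel_def by blast
  then obtain u where u: "\<And>i. i \<in> I \<Longrightarrow> u i \<in> M"
    and eu: "\<And>i. i \<in> I \<Longrightarrow> e i = u i o\<^sub>L adj (u i)" and fu: "\<And>i. i \<in> I \<Longrightarrow> f i = adj (u i) o\<^sub>L u i"
    by metis
  have e': "orthogonal_projections I (\<lambda>i. u i o\<^sub>L adj (u i))"
    and f': "orthogonal_projections I (\<lambda>i. adj (u i) o\<^sub>L u i)"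
    using e f unfolding orthogonal_projections_def by (simp_all flip: eu fu)
  obtain U where U: "strong_sum I u U"
    using strong_sum_partial_isometries [OF u e' f'] by blast
  have e'': "orthogonal_projections I (\<lambda>i. adj (u i) o\<^sub>L adj (adj (u i)))"
    and f'': "orthogonal_projections I (\<lambda>i. adj (adj (u i)) o\<^sub>L adj (u i))"
    using e' f' unfolding orthogonal_projections_def by (simp_all add: u)
  obtain V where V: "strong_sum I (\<lambda>i. adj (u i)) V"
    using strong_sum_partial_isometries [OF _ e'' f''] u by fastforce
  have VU: "adj U = V"
    by (rule strong_sum_adj [OF u U V])
  have pi: "u i (adj (u i) (u i v)) = u i v" if "i \<in> I" for i v
    using partial_isometry(1) [OF u [OF that], of v] orthogonal_projectionsD(1) [OF f' that]
    by (simp add: projectionsD(3))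
  have pi': "adj (u i) (u i (adj (u i) v)) = adj (u i) v" if "i \<in> I" for i v
    using partial_isometry(1) [of "adj (u i)" v] orthogonal_projectionsD(1) [OF e' that] u [OF that]
    by (simp add: projectionsD(3))
  have z1: "adj (u i) (u j v) = 0" if "i \<in> I" "j \<in> I" "i \<noteq> j" for i j v
  proof -
    have "adj (u i) (u j v) = adj (u i) (((u i o\<^sub>L adj (u i)) o\<^sub>L (u j o\<^sub>L adj (u j))) (u j v))"
      using that by (simp add: pi pi')
    then show ?thesis
      using orthogonal_projectionsD(2) [OF e', of i j] that by simp
  qed
  have z2: "u i (adj (u j) v) = 0" if "i \<in> I" "j \<in> I" "i \<noteq> j" for i j v
  proof -
    have "u i (adj (u j) v) = u i (((adj (u i) o\<^sub>L u i) o\<^sub>L (adj (u j) o\<^sub>L u j)) (adj (u j) v))"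
      using that by (simp add: pi pi')
    then show ?thesis
      using orthogonal_projectionsD(2) [OF f', of i j] that by simp
  qed
  have "adj U o\<^sub>L U = F"
  proof (rule blinfun_eqI)
    fix v
    have *: "adj (u i) (U v) = f i v" if i: "i \<in> I" for i
    proof (rule has_sum_unique)
      show "((\<lambda>j. adj (u i) (u j v)) has_sum adj (u i) (U v)) I"
        by (rule has_sum_blinfun_apply [OF strong_sumD [OF U]])
      show "((\<lambda>j. adj (u i) (u j v)) has_sum f i v) I"
        using has_sum_single [OF i, of "\<lambda>j. adj (u i) (u j v)"] z1 [OF i] by (simp add: fu i)
    qed
    have "((\<lambda>i. f i v) has_sum V (U v)) I"
      using strong_sumD [OF V, of "U v"] has_sum_cong [of I "\<lambda>i. adj (u i) (U v)" "\<lambda>i. f i v"] * by auto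
    then show "(adj U o\<^sub>L U) v = F v"
      using strong_sumD [OF F(2), of v] has_sum_unique by (force simp: VU)
  qed
  moreover have "U o\<^sub>L adj U = E"
  proof (rule blinfun_eqI)
    fix v
    have *: "u i (V v) = e i v" if i: "i \<in> I" for i
    proof (rule has_sum_unique)
      show "((\<lambda>j. u i (adj (u j) v)) has_sum u i (V v)) I"
        by (rule has_sum_blinfun_apply [OF strong_sumD [OF V]])
      show "((\<lambda>j. u i (adj (u j) v)) has_sum e i v) I"
        using has_sum_single [OF i, of "\<lambda>j. u i (adj (u j) v)"] z2 [OF i] by (simp add: eu i)
    qed
    have "((\<lambda>i. e i v) has_sum U (V v)) I"
      using strong_sumD [OF U, of "V v"] has_sum_cong [of I "\<lambda>i. u i (V v)" "\<lambda>i. e i v"] * by auto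
    then show "(U o\<^sub>L adj U) v = E v"
      using strong_sumD [OF E(2), of v] has_sum_unique by (force simp: VU)
  qed
  moreover have "U \<in> M"
    using U by (simp add: strong_sum_def)
  ultimately show ?thesis
    using mvn_relI [OF E(1) F(1), of U] by metis
qed

end


section \<open>Traces\<close>

lemma topspace_ultraweak [simp]: "topspace (ultraweak_topology :: ('h::chilbert_space \<Rightarrow>\<^sub>L 'h) topology) = UNIV"
proof -
  let ?S = "{{T::'h \<Rightarrow>\<^sub>L 'h. (\<Sum>n. cinner (blinfun_apply T (x n)) (y n)) \<in> U} | (x :: nat \<Rightarrow> 'h) (y :: nat \<Rightarrow> 'h) U.
        summable (\<lambda>n. (norm (x n))\<^sup>2) \<and> summable (\<lambda>n. (norm (y n))\<^sup>2) \<and> open U}"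
  have "UNIV \<in> ?S"
    by (rule CollectI, rule exI [of _ "\<lambda>_. 0"], rule exI [of _ "\<lambda>_. 0"], rule exI [of _ UNIV]) auto
  then have "UNIV \<subseteq> \<Union>?S"
    by (rule Union_upper)
  then show ?thesis
    unfolding ultraweak_topology_def topology_generated_by_topspace by (rule top.extremum_uniqueI)
qed

context vna
begin

lemma trace_mvn:
  assumes "vna_trace M \<tau>" "(p, q) \<in> mvn_rel M"
  shows "\<tau> p = \<tau> q"
proof -
  obtain u where "u \<in> M" "p = u o\<^sub>L adj u" "q = adj u o\<^sub>L u"
    using assms(2) unfolding mvn_rel_def by blast
  then show ?thesis
    using assms(1) unfolding vna_trace_def by simp
qed

lemma trace_zero:
  assumes "vna_trace M \<tau>" shows "\<tau> 0 = 0"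
proof -
  have "\<tau> (0 *\<^sub>R 0) = ennreal 0 * \<tau> 0"
    using assms proj_positive [OF zero_proj] unfolding vna_trace_def by blast
  then show ?thesis by simp
qed

lemma trace_add:
  assumes "vna_trace M \<tau>" "x \<in> positives M" "y \<in> positives M"
  shows "\<tau> (x + y) = \<tau> x + \<tau> y"
  using assms unfolding vna_trace_def by blast

lemma trace_sum_projections:
  assumes \<tau>: "vna_trace M \<tau>" and e: "orthogonal_projections I e" and F: "finite F" "F \<subseteq> I"
  shows "\<tau> (sum e F) = (\<Sum>i\<in>F. \<tau> (e i))"
  using F
proof (induction F)
  case empty
  then show ?case by (simp add: trace_zero [OF \<tau>])
next
  case (insert i F)
  then have "e i \<in> positives M" "sum e F \<in> positives M"
    using orthogonal_projectionsD(1) [OF e] sum_orthogonal_projections [OF e]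
    by (auto intro: proj_positive)
  then show ?case
    using insert trace_add [OF \<tau>] by simp
qed

text \<open>Normality becomes complete additivity: the finite partial sums are projections, so they
  are bounded by 1 in norm and their strong convergence is also ultraweak.\<close>

lemma trace_strong_sum:
  assumes \<tau>: "vna_trace M \<tau>" and normal: "normal_trace M \<tau>"
    and e: "orthogonal_projections I e" and E: "E \<in> projections M" "strong_sum I e E"
  shows "((\<lambda>i. \<tau> (e i)) has_sum \<tau> E) I"
proof -
  define T where "T F = (if finite F \<and> F \<subseteq> I then sum e F else 0)" for F
  have T: "T F \<in> projections M" for F
    using sum_orthogonal_projections [OF e] by (simp add: T_def)
  have lim: "((\<lambda>F. T F v) \<longlongrightarrow> E v) (finite_subsets_at_top I)" for v
  proof (rule Lim_transform_eventually)
    show "((\<lambda>F. \<Sum>i\<in>F. e i v) \<longlongrightarrow> E v) (finite_subsets_at_top I)"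
      using strong_sumD [OF E(2), of v] by (simp add: has_sum_def)
    show "\<forall>\<^sub>F F in finite_subsets_at_top I. (\<Sum>i\<in>F. e i v) = T F v"
      by (rule eventually_finite_subsets_at_top_weakI) (simp add: T_def sum_blinfun_apply)
  qed
  have "norm (T F) \<le> 1" for F
    by (rule norm_blinfun_bound) (simp_all add: proj_norm_le [OF T])
  then have "limitin ultraweak_topology T E (finite_subsets_at_top I)"
    by (rule limitin_ultraweak [OF lim])
  then have "limitin (subtopology ultraweak_topology (positives M)) T E (finite_subsets_at_top I)"
    by (simp add: limitin_subtopology proj_positive [OF E(1)] proj_positive [OF T])
  with normal have "limitin euclidean (\<tau> \<circ> T) (\<tau> E) (finite_subsets_at_top I)"
    unfolding normal_trace_def by (rule continuous_map_limit)
  then have "((\<lambda>F. \<tau> (T F)) \<longlongrightarrow> \<tau> E) (finite_subsets_at_top I)"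
    by (simp add: o_def)
  then show ?thesis
    unfolding has_sum_def
  proof (rule Lim_transform_eventually)
    show "\<forall>\<^sub>F F in finite_subsets_at_top I. \<tau> (T F) = (\<Sum>i\<in>F. \<tau> (e i))"
      by (rule eventually_finite_subsets_at_top_weakI)
        (simp add: T_def trace_sum_projections [OF \<tau> e])
  qed
qed

section \<open>Compression of a trace by a central projection\<close>

lemma ultraweak_continuous_compress:
  assumes z: "z \<in> projections M"
  shows "continuous_map ultraweak_topology ultraweak_topology (\<lambda>x. z o\<^sub>L (x o\<^sub>L z))"
proof -
  let ?S = "{{T::'h \<Rightarrow>\<^sub>L 'h. (\<Sum>n. cinner (blinfun_apply T (x n)) (y n)) \<in> U} | (x :: nat \<Rightarrow> 'h) (y :: nat \<Rightarrow> 'h) U.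
        summable (\<lambda>n. (norm (x n))\<^sup>2) \<and> summable (\<lambda>n. (norm (y n))\<^sup>2) \<and> open U}"
  have z_lin: "z (c *\<^sub>C v) = c *\<^sub>C z v" for c v
    by (rule bounded_opsD [OF bounded_ops [OF projectionsD(1) [OF z]]])
  have cz: "cinner (z v) w = cinner v (z w)" for v w
    by (rule cinner_eqI) (simp add: projectionsD(5) [OF z] z_lin)
  have sz: "summable (\<lambda>n. (norm (z (x n)))\<^sup>2)" if "summable (\<lambda>n. (norm (x n))\<^sup>2)" for x :: "nat \<Rightarrow> 'h"
    by (rule summable_comparison_test' [OF that, of 0])
      (simp add: power_mono proj_norm_le [OF z])
  \<comment> \<open>The preimage of the subbasic set given by \<open>x\<close> and \<open>y\<close>
    is the one given by \<open>z (x n)\<close> and \<open>z (y n)\<close>, again square summable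
    since \<open>z\<close> is a contraction.\<close>
  have pre: "(\<lambda>x. z o\<^sub>L (x o\<^sub>L z)) -` V \<in> ?S" if "V \<in> ?S" for V
  proof -
    from that obtain x y :: "nat \<Rightarrow> 'h" and U
      where V: "V = {T. (\<Sum>n. cinner (blinfun_apply T (x n)) (y n)) \<in> U}"
        and xy: "summable (\<lambda>n. (norm (x n))\<^sup>2)" "summable (\<lambda>n. (norm (y n))\<^sup>2)" and U: "open U"
      by blast
    have "(\<lambda>x. z o\<^sub>L (x o\<^sub>L z)) -` V = {T. (\<Sum>n. cinner (blinfun_apply T (z (x n))) (z (y n))) \<in> U}"
      by (simp add: V vimage_def cz)
    then show ?thesis
      using sz [OF xy(1)] sz [OF xy(2)] U
      by (intro CollectI exI [of _ "\<lambda>n. z (x n)"] exI [of _ "\<lambda>n. z (y n)"] exI [of _ U]) simp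
  qed
  show ?thesis
  proof (subst (2) ultraweak_topology_def, rule continuous_on_generated_topo)
    show "openin ultraweak_topology ((\<lambda>x. z o\<^sub>L (x o\<^sub>L z)) -` V \<inter> topspace ultraweak_topology)"
      if "V \<in> ?S" for V
      using topology_generated_by_Basis [OF pre [OF that]] by (simp add: ultraweak_topology_def [symmetric])
    have "\<Union>?S = UNIV"
      using topspace_ultraweak unfolding ultraweak_topology_def topology_generated_by_topspace .
    then show "(\<lambda>x. z o\<^sub>L (x o\<^sub>L z)) ` topspace ultraweak_topology \<subseteq> \<Union>?S"
      by simp
  qed
qed

lemma compress_positive:
  assumes z: "z \<in> projections M" and x: "x \<in> positives M"
  shows "z o\<^sub>L (x o\<^sub>L z) \<in> positives M"
proof -
  obtain y where y: "x \<in> M" "y \<in> M" "x = y o\<^sub>L adj y"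
    using x unfolding positives_def by blast
  have "z o\<^sub>L (x o\<^sub>L z) = (z o\<^sub>L y) o\<^sub>L adj (z o\<^sub>L y)"
    using y(2,3) projectionsD(1,2) [OF z] by (simp add: blinfun_compose_assoc)
  moreover have "z o\<^sub>L y \<in> M" "z o\<^sub>L (x o\<^sub>L z) \<in> M"
    using y(1,2) projectionsD(1) [OF z] by simp_all
  ultimately show ?thesis
    unfolding positives_def by blast
qed

text \<open>Centrality gives the trace identity: it lets \<open>z\<close> pass \<open>adj m\<close>
  and \<open>m\<close>, so that both compressed products are those of the single element
  \<open>z o\<^sub>L m\<close>.\<close>

lemma compressed_trace:
  assumes z: "z \<in> projections M" and central: "\<And>m. m \<in> M \<Longrightarrow> z o\<^sub>L m = m o\<^sub>L z"
    and \<tau>: "vna_trace M \<tau>" "finite_trace M \<tau>" "normal_trace M \<tau>"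
  shows "vna_trace M (\<lambda>x. \<tau> (z o\<^sub>L (x o\<^sub>L z)))" "finite_trace M (\<lambda>x. \<tau> (z o\<^sub>L (x o\<^sub>L z)))"
    "normal_trace M (\<lambda>x. \<tau> (z o\<^sub>L (x o\<^sub>L z)))"
proof -
  note pos = compress_positive [OF z]
  have zM: "z \<in> M" and zz: "z o\<^sub>L z = z" and za: "adj z = z"
    using projectionsD [OF z] by auto
  show "vna_trace M (\<lambda>x. \<tau> (z o\<^sub>L (x o\<^sub>L z)))"
    unfolding vna_trace_def
  proof (intro conjI ballI allI impI)
    show "\<tau> (z o\<^sub>L (x + y o\<^sub>L z)) = \<tau> (z o\<^sub>L (x o\<^sub>L z)) + \<tau> (z o\<^sub>L (y o\<^sub>L z))"
      if "x \<in> positives M" "y \<in> positives M" for x y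
    proof -
      have "z o\<^sub>L (x + y o\<^sub>L z) = (z o\<^sub>L (x o\<^sub>L z)) + (z o\<^sub>L (y o\<^sub>L z))"
        by (rule blinfun_eqI) (simp add: blinfun.add_left blinfun.add_right)
      then show ?thesis
        by (simp add: trace_add [OF \<tau>(1)] pos that)
    qed
    show "\<tau> (z o\<^sub>L (c *\<^sub>R x o\<^sub>L z)) = ennreal c * \<tau> (z o\<^sub>L (x o\<^sub>L z))"
      if "c \<ge> 0" "x \<in> positives M" for c x
    proof -
      have "z o\<^sub>L (c *\<^sub>R x o\<^sub>L z) = c *\<^sub>R (z o\<^sub>L (x o\<^sub>L z))"
        by (rule blinfun_eqI) (simp add: blinfun.scaleR_left blinfun.scaleR_right)
      moreover have "\<tau> (c *\<^sub>R (z o\<^sub>L (x o\<^sub>L z))) = ennreal c * \<tau> (z o\<^sub>L (x o\<^sub>L z))"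
        using \<tau>(1) pos [OF that(2)] that(1) unfolding vna_trace_def by blast
      ultimately show ?thesis by simp
    qed
    show "\<tau> (z o\<^sub>L ((m o\<^sub>L adj m) o\<^sub>L z)) = \<tau> (z o\<^sub>L ((adj m o\<^sub>L m) o\<^sub>L z))" if m: "m \<in> M" for m
    proof -
      have "z o\<^sub>L ((m o\<^sub>L adj m) o\<^sub>L z) = (z o\<^sub>L m) o\<^sub>L adj (z o\<^sub>L m)"
        using m zM by (simp add: za blinfun_compose_assoc)
      moreover have "z o\<^sub>L ((adj m o\<^sub>L m) o\<^sub>L z) = adj (z o\<^sub>L m) o\<^sub>L (z o\<^sub>L m)"
      proof -
        have "z o\<^sub>L ((adj m o\<^sub>L m) o\<^sub>L z) = (z o\<^sub>L adj m) o\<^sub>L (m o\<^sub>L z)"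
          by (simp add: blinfun_compose_assoc)
        also have "\<dots> = (adj m o\<^sub>L z) o\<^sub>L (z o\<^sub>L m)"
          using central m by simp
        finally show ?thesis
          using m zM by (simp add: za)
      qed
      moreover have "\<tau> ((z o\<^sub>L m) o\<^sub>L adj (z o\<^sub>L m)) = \<tau> (adj (z o\<^sub>L m) o\<^sub>L (z o\<^sub>L m))"
        using \<tau>(1) comp_in [OF zM m] unfolding vna_trace_def by blast
      ultimately show ?thesis by simp
    qed
  qed
  show "finite_trace M (\<lambda>x. \<tau> (z o\<^sub>L (x o\<^sub>L z)))"
    using \<tau>(2) pos unfolding finite_trace_def by blast
  have "continuous_map (subtopology ultraweak_topology (positives M))
      (subtopology ultraweak_topology (positives M)) (\<lambda>x. z o\<^sub>L (x o\<^sub>L z))"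
    unfolding continuous_map_in_subtopology
    using pos by (auto intro: continuous_map_from_subtopology ultraweak_continuous_compress [OF z])
  from continuous_map_compose [OF this \<tau>(3) [unfolded normal_trace_def]]
  show "normal_trace M (\<lambda>x. \<tau> (z o\<^sub>L (x o\<^sub>L z)))"
    unfolding normal_trace_def by (simp add: o_def)
qed

text \<open>The values \<open>b\<close> are attached to classes, not to representatives, so that
  both sums of an equidecomposition can be evaluated with one and the same \<open>b\<close>.\<close>

lemma class_sum_trace:
  assumes \<tau>: "vna_trace M \<tau>" "normal_trace M \<tau>"
    and sum: "class_sum M I a (mvn_class M p)" and p: "p \<in> projections M"
    and b: "\<And>i r. i \<in> I \<Longrightarrow> r \<in> a i \<Longrightarrow> \<tau> r = b i"
  shows "(b has_sum \<tau> p) I"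
proof -
  have cls: "\<forall>i\<in>I. a i \<in> mvn_classes M"
    and "\<exists>P s. (\<forall>i\<in>I. P i \<in> a i) \<and> (\<forall>i\<in>I. \<forall>j\<in>I. i \<noteq> j \<longrightarrow> P i o\<^sub>L P j = 0) \<and>
      is_join M I P s \<and> mvn_class M p = mvn_class M s"
    using sum unfolding class_sum_def by simp_all
  then obtain P s where P: "\<forall>i\<in>I. P i \<in> a i"
    and orth: "\<forall>i\<in>I. \<forall>j\<in>I. i \<noteq> j \<longrightarrow> P i o\<^sub>L P j = 0"
    and join: "is_join M I P s" and ps: "mvn_class M p = mvn_class M s"
    by (elim exE conjE) simp
  have "P i \<in> projections M" if "i \<in> I" for i
    using mvn_classesD(1) [of "a i" "P i"] cls P that by simp
  then have OP: "orthogonal_projections I P"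
    using orth by (simp add: orthogonal_projections_def)
  obtain E where E: "E \<in> projections M" "strong_sum I P E"
    by (rule strong_sum_projection [OF OP])
  have "s = E"
    using join is_join_strong_sum_iff [OF OP E] by blast
  then have "\<tau> p = \<tau> E"
    using ps by (intro trace_mvn [OF \<tau>(1)]) (simp add: mvn_class_eq_iff [OF p E(1)])
  moreover have "((\<lambda>i. \<tau> (P i)) has_sum \<tau> E) I"
    by (rule trace_strong_sum [OF \<tau> OP E])
  moreover have "((\<lambda>i. \<tau> (P i)) has_sum \<tau> E) I \<longleftrightarrow> (b has_sum \<tau> E) I"
    by (rule has_sum_cong) (simp add: b P)
  ultimately show ?thesis by simp
qed

end


section \<open>Group actions and equidecomposability\<close>

text \<open>Zorn's lemma, for a relation that need not be symmetric; hence the two orders in the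
  maximality clause.\<close>

lemma maximal_pairwise:
  "\<exists>Y\<subseteq>B. pairwise R Y \<and> (\<forall>b\<in>B. (\<forall>y\<in>Y. R b y \<and> R y b) \<longrightarrow> b \<in> Y)"
proof -
  let ?A = "{Y. Y \<subseteq> B \<and> pairwise R Y}"
  have "\<exists>Y\<in>?A. \<forall>X\<in>?A. Y \<subseteq> X \<longrightarrow> X = Y"
  proof (rule subset_Zorn')
    fix C assume C: "subset.chain ?A C"
    then have sub: "C \<subseteq> ?A"
      by (simp add: subset_chain_def)
    have "R x y" if xy: "x \<in> \<Union>C" "y \<in> \<Union>C" "x \<noteq> y" for x y
    proof -
      obtain X Y where XY: "X \<in> C" "Y \<in> C" "x \<in> X" "y \<in> Y"
        using xy by blast
      then have "X \<subseteq> Y \<or> Y \<subseteq> X"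
        using C unfolding subset_chain_def by simp
      then obtain Z where "Z \<in> C" "x \<in> Z" "y \<in> Z"
        using XY by blast
      then show ?thesis
        using sub xy(3) unfolding pairwise_def by blast
    qed
    then show "\<Union>C \<in> ?A"
      using sub unfolding pairwise_def by blast
  qed
  then obtain Y where Y: "Y \<subseteq> B" "pairwise R Y" and max: "\<forall>X\<in>?A. Y \<subseteq> X \<longrightarrow> X = Y"
    by (elim bexE) auto
  have "b \<in> Y" if "b \<in> B" "\<forall>y\<in>Y. R b y \<and> R y b" for b
  proof -
    have "insert b Y \<in> ?A"
      using that Y by (simp add: pairwise_insert)
    then have "insert b Y = Y"
      using max by blast
    then show ?thesis by blast
  qed
  with Y show ?thesis by blast
qed

locale vna_dynamics = vna M
  for \<Gamma> :: "('g, 'm) monoid_scheme" and M :: "('h::chilbert_space \<Rightarrow>\<^sub>L 'h) set"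
    and \<alpha> :: "'g \<Rightarrow> ('h \<Rightarrow>\<^sub>L 'h) \<Rightarrow> ('h \<Rightarrow>\<^sub>L 'h)" +
  assumes group: "group \<Gamma>" and action: "vna_action \<Gamma> M \<alpha>"
begin

section \<open>The action on projections, classes and strong sums\<close>

lemma group_action: "group_action \<Gamma> M \<alpha>"
  using action by (simp add: vna_action_def)

lemma act_in [simp]: "\<gamma> \<in> carrier \<Gamma> \<Longrightarrow> x \<in> M \<Longrightarrow> \<alpha> \<gamma> x \<in> M"
  using group_action.surj_prop [OF group_action] by blast

lemma act_comp: "\<gamma> \<in> carrier \<Gamma> \<Longrightarrow> x \<in> M \<Longrightarrow> y \<in> M \<Longrightarrow> \<alpha> \<gamma> (x o\<^sub>L y) = \<alpha> \<gamma> x o\<^sub>L \<alpha> \<gamma> y"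
  and act_adj: "\<gamma> \<in> carrier \<Gamma> \<Longrightarrow> x \<in> M \<Longrightarrow> \<alpha> \<gamma> (adj x) = adj (\<alpha> \<gamma> x)"
  and act_zero: "\<gamma> \<in> carrier \<Gamma> \<Longrightarrow> \<alpha> \<gamma> 0 = 0"
  using action by (auto simp: vna_action_def)

lemma one_carrier [simp]: "\<one>\<^bsub>\<Gamma>\<^esub> \<in> carrier \<Gamma>"
  and mult_carrier [simp]: "\<gamma> \<in> carrier \<Gamma> \<Longrightarrow> \<delta> \<in> carrier \<Gamma> \<Longrightarrow> \<gamma> \<otimes>\<^bsub>\<Gamma>\<^esub> \<delta> \<in> carrier \<Gamma>"
  and inv_carrier [simp]: "\<gamma> \<in> carrier \<Gamma> \<Longrightarrow> inv\<^bsub>\<Gamma>\<^esub> \<gamma> \<in> carrier \<Gamma>"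
  using group by (auto simp: group.inv_closed group.is_monoid monoid.m_closed)

lemma act_one: "x \<in> M \<Longrightarrow> \<alpha> \<one>\<^bsub>\<Gamma>\<^esub> x = x"
  using group_action.id_eq_one [OF group_action] by (metis restrict_apply')

lemma act_mult: "\<gamma> \<in> carrier \<Gamma> \<Longrightarrow> \<delta> \<in> carrier \<Gamma> \<Longrightarrow> x \<in> M \<Longrightarrow> \<alpha> (\<gamma> \<otimes>\<^bsub>\<Gamma>\<^esub> \<delta>) x = \<alpha> \<gamma> (\<alpha> \<delta> x)"
  by (rule group_action.composition_rule [OF group_action])

lemma act_act_inv: "\<gamma> \<in> carrier \<Gamma> \<Longrightarrow> x \<in> M \<Longrightarrow> \<alpha> \<gamma> (\<alpha> (inv\<^bsub>\<Gamma>\<^esub> \<gamma>) x) = x"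
  by (metis act_mult act_one inv_carrier group group.r_inv)

lemma act_inv_act: "\<gamma> \<in> carrier \<Gamma> \<Longrightarrow> x \<in> M \<Longrightarrow> \<alpha> (inv\<^bsub>\<Gamma>\<^esub> \<gamma>) (\<alpha> \<gamma> x) = x"
  by (metis act_mult act_one inv_carrier group group.l_inv)

lemma act_projection:
  assumes \<gamma>: "\<gamma> \<in> carrier \<Gamma>" and p: "p \<in> projections M"
  shows "\<alpha> \<gamma> p \<in> projections M"
  by (rule projectionsI) (simp_all add: \<gamma> projectionsD [OF p] flip: act_adj act_comp)

lemma act_mvn:
  assumes \<gamma>: "\<gamma> \<in> carrier \<Gamma>" and pq: "(p, q) \<in> mvn_rel M"
  shows "(\<alpha> \<gamma> p, \<alpha> \<gamma> q) \<in> mvn_rel M"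
proof -
  obtain u where u: "u \<in> M" "p = u o\<^sub>L adj u" "q = adj u o\<^sub>L u"
    using pq unfolding mvn_rel_def by blast
  have "\<alpha> \<gamma> p \<in> projections M" "\<alpha> \<gamma> q \<in> projections M"
    using mvn_proj [OF pq] act_projection [OF \<gamma>] by simp_all
  moreover have "\<alpha> \<gamma> p = \<alpha> \<gamma> u o\<^sub>L adj (\<alpha> \<gamma> u)" "\<alpha> \<gamma> q = adj (\<alpha> \<gamma> u) o\<^sub>L \<alpha> \<gamma> u"
    by (simp_all add: u \<gamma> act_comp act_adj)
  ultimately show ?thesis
    by (intro mvn_relI [of _ _ "\<alpha> \<gamma> u"]) (simp_all add: u \<gamma>)
qed

lemma act_orthogonal_projections:
  assumes \<gamma>: "\<gamma> \<in> carrier \<Gamma>" and e: "orthogonal_projections I e"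
  shows "orthogonal_projections I (\<lambda>i. \<alpha> \<gamma> (e i))"
  unfolding orthogonal_projections_def
proof (intro conjI ballI impI)
  show "\<alpha> \<gamma> (e i) \<in> projections M" if "i \<in> I" for i
    by (rule act_projection [OF \<gamma> orthogonal_projectionsD(1) [OF e that]])
  show "\<alpha> \<gamma> (e i) o\<^sub>L \<alpha> \<gamma> (e j) = 0" if "i \<in> I" "j \<in> I" "i \<noteq> j" for i j
  proof -
    have "\<alpha> \<gamma> (e i) o\<^sub>L \<alpha> \<gamma> (e j) = \<alpha> \<gamma> (e i o\<^sub>L e j)"
      using that e by (simp add: act_comp \<gamma> projectionsD(1) orthogonal_projectionsD(1))
    then show ?thesis
      using orthogonal_projectionsD(2) [OF e that] by (simp add: act_zero \<gamma>)
  qed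
qed

text \<open>An automorphism preserves the order of projections, hence joins, that is, strong sums.\<close>

lemma act_strong_sum:
  assumes \<gamma>: "\<gamma> \<in> carrier \<Gamma>" and e: "orthogonal_projections I e"
    and E: "E \<in> projections M" "strong_sum I e E"
  shows "strong_sum I (\<lambda>i. \<alpha> \<gamma> (e i)) (\<alpha> \<gamma> E)"
proof -
  let ?\<delta> = "inv\<^bsub>\<Gamma>\<^esub> \<gamma>"
  have \<delta>: "?\<delta> \<in> carrier \<Gamma>" using \<gamma> by simp
  have EM: "E \<in> M" by (rule projectionsD(1) [OF E(1)])
  have eM: "e i \<in> M" if "i \<in> I" for i
    using orthogonal_projectionsD(1) [OF e that] by (rule projectionsD(1))
  note e' = act_orthogonal_projections [OF \<gamma> e]
  obtain F where F: "F \<in> projections M" "strong_sum I (\<lambda>i. \<alpha> \<gamma> (e i)) F"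
    by (rule strong_sum_projection [OF e'])
  have FM: "F \<in> M" by (rule projectionsD(1) [OF F(1)])
  have "\<alpha> \<gamma> E o\<^sub>L F = F"
  proof (rule strong_sum_least [OF F(2)])
    show "\<alpha> \<gamma> E o\<^sub>L \<alpha> \<gamma> (e i) = \<alpha> \<gamma> (e i)" if "i \<in> I" for i
      using strong_sum_ge [OF e E(2) that] by (simp add: \<gamma> EM eM that flip: act_comp)
  qed
  moreover have "F o\<^sub>L \<alpha> \<gamma> E = \<alpha> \<gamma> E"
  proof -
    have "\<alpha> ?\<delta> F o\<^sub>L E = E"
    proof (rule strong_sum_least [OF E(2)])
      fix i assume i: "i \<in> I"
      have "\<alpha> ?\<delta> F o\<^sub>L e i = \<alpha> ?\<delta> F o\<^sub>L \<alpha> ?\<delta> (\<alpha> \<gamma> (e i))"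
        by (simp add: act_inv_act \<gamma> eM i)
      also have "\<dots> = \<alpha> ?\<delta> (F o\<^sub>L \<alpha> \<gamma> (e i))"
        by (rule act_comp [OF \<delta> FM, symmetric]) (simp add: \<gamma> eM i)
      also have "\<dots> = e i"
        using strong_sum_ge [OF e' F(2) i] by (simp add: act_inv_act \<gamma> eM i)
      finally show "\<alpha> ?\<delta> F o\<^sub>L e i = e i" .
    qed
    then have "\<alpha> \<gamma> (\<alpha> ?\<delta> F o\<^sub>L E) = \<alpha> \<gamma> E"
      by simp
    then show ?thesis
      by (simp add: act_comp \<gamma> \<delta> FM EM act_act_inv)
  qed
  ultimately have "F = \<alpha> \<gamma> E"
    by (rule proj_antisym [OF F(1) act_projection [OF \<gamma> E(1)]])
  then show ?thesis
    using F(2) by simp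
qed

lemma class_action_mvn_class:
  assumes \<gamma>: "\<gamma> \<in> carrier \<Gamma>" and p: "p \<in> projections M"
  shows "class_action M \<alpha> \<gamma> (mvn_class M p) = mvn_class M (\<alpha> \<gamma> p)"
proof -
  have *: "mvn_class M (\<alpha> \<gamma> r) = mvn_class M (\<alpha> \<gamma> p)" if "r \<in> mvn_class M p" for r
  proof -
    have pr: "(p, r) \<in> mvn_rel M"
      using that by (simp add: mem_mvn_class)
    then have r: "r \<in> projections M"
      using mvn_proj by simp
    have "(\<alpha> \<gamma> r, \<alpha> \<gamma> p) \<in> mvn_rel M"
      by (rule act_mvn [OF \<gamma> mvn_sym [OF pr]])
    then show ?thesis
      by (simp add: mvn_class_eq_iff act_projection \<gamma> r p)
  qed
  have "p \<in> mvn_class M p"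
    by (simp add: mem_mvn_class mvn_refl p)
  then show ?thesis
    unfolding class_action_def using * by blast
qed

lemma equidecomposable_imp_trace_eq:
  assumes \<tau>: "vna_trace M \<tau>" "normal_trace M \<tau>" "invariant_trace \<Gamma> M \<alpha> \<tau>"
    and p: "p \<in> projections M" and q: "q \<in> projections M"
    and eq: "equidecomposable \<Gamma> M \<alpha> (mvn_class M p) (mvn_class M q)"
  shows "\<tau> p = \<tau> q"
proof -
  obtain a where a: "\<forall>\<gamma>\<in>carrier \<Gamma>. a \<gamma> \<in> mvn_classes M"
    and sp: "class_sum M (carrier \<Gamma>) a (mvn_class M p)"
    and sq: "class_sum M (carrier \<Gamma>) (\<lambda>\<gamma>. class_action M \<alpha> \<gamma> (a \<gamma>)) (mvn_class M q)"
    using eq unfolding equidecomposable_def by (elim exE conjE)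
  \<comment> \<open>The chosen representative is immaterial, since a trace is constant on each
    class.\<close>
  define b where "b \<gamma> = \<tau> (SOME r. r \<in> a \<gamma>)" for \<gamma>
  have b: "\<tau> r = b \<gamma>" if \<gamma>: "\<gamma> \<in> carrier \<Gamma>" and r: "r \<in> a \<gamma>" for r \<gamma>
  proof -
    have cls: "a \<gamma> \<in> mvn_classes M"
      using a \<gamma> by simp
    have "(SOME r. r \<in> a \<gamma>) \<in> a \<gamma>"
      using r by (rule someI)
    then have "(r, SOME r. r \<in> a \<gamma>) \<in> mvn_rel M"
      unfolding mvn_classesD(2) [OF cls r] by (simp add: mem_mvn_class)
    then show ?thesis
      unfolding b_def by (rule trace_mvn [OF \<tau>(1)])
  qed
  have "(b has_sum \<tau> p) (carrier \<Gamma>)"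
    by (rule class_sum_trace [OF \<tau>(1,2) sp p b])
  moreover have "(b has_sum \<tau> q) (carrier \<Gamma>)"
  proof (rule class_sum_trace [OF \<tau>(1,2) sq q])
    fix \<gamma> r assume \<gamma>: "\<gamma> \<in> carrier \<Gamma>" and "r \<in> class_action M \<alpha> \<gamma> (a \<gamma>)"
    then obtain p' where p': "p' \<in> a \<gamma>" "(\<alpha> \<gamma> p', r) \<in> mvn_rel M"
      unfolding class_action_def by (auto simp: mem_mvn_class)
    have "p' \<in> positives M"
      using a \<gamma> p'(1) by (intro proj_positive mvn_classesD(1) [of "a \<gamma>"]) auto
    then have "\<tau> (\<alpha> \<gamma> p') = \<tau> p'"
      using \<tau>(3) \<gamma> by (simp add: invariant_trace_def)
    then show "\<tau> r = b \<gamma>"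
      using trace_mvn [OF \<tau>(1) p'(2)] b [OF \<gamma> p'(1)] by simp
  qed
  ultimately show ?thesis
    by (rule has_sum_unique)
qed

text \<open>Closed under equivalence, translation and passage to subprojections, as shown next.
  Equivalence and subprojections make the join of this set central; translation makes it
  invariant.\<close>

definition orbit_subprojections :: "('h \<Rightarrow>\<^sub>L 'h) \<Rightarrow> ('h \<Rightarrow>\<^sub>L 'h) set" where
  "orbit_subprojections p =
     {r. \<exists>\<gamma>\<in>carrier \<Gamma>. \<exists>e\<in>projections M. p o\<^sub>L e = e \<and> (\<alpha> \<gamma> e, r) \<in> mvn_rel M}"

lemma orbit_subprojectionsI:
  "\<lbrakk>\<gamma> \<in> carrier \<Gamma>; e \<in> projections M; p o\<^sub>L e = e; (\<alpha> \<gamma> e, r) \<in> mvn_rel M\<rbrakk> \<Longrightarrow>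
    r \<in> orbit_subprojections p"
  unfolding orbit_subprojections_def by blast

lemma orbit_subprojectionsE:
  assumes "r \<in> orbit_subprojections p"
  obtains \<gamma> e where "\<gamma> \<in> carrier \<Gamma>" "e \<in> projections M" "p o\<^sub>L e = e" "(\<alpha> \<gamma> e, r) \<in> mvn_rel M"
  using assms unfolding orbit_subprojections_def by blast

lemma orbit_subprojections_proj: "r \<in> orbit_subprojections p \<Longrightarrow> r \<in> projections M"
  by (erule orbit_subprojectionsE) (simp add: mvn_proj)

lemma orbit_subprojections_self: "p \<in> projections M \<Longrightarrow> p \<in> orbit_subprojections p"
  by (rule orbit_subprojectionsI [of "\<one>\<^bsub>\<Gamma>\<^esub>" p]) (simp_all add: act_one mvn_refl projectionsD)

lemma orbit_subprojections_mvn: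
  assumes "r \<in> orbit_subprojections p" "(r, r') \<in> mvn_rel M"
  shows "r' \<in> orbit_subprojections p"
  using assms(1)
proof (rule orbit_subprojectionsE)
  fix \<gamma> e assume *: "\<gamma> \<in> carrier \<Gamma>" "e \<in> projections M" "p o\<^sub>L e = e" "(\<alpha> \<gamma> e, r) \<in> mvn_rel M"
  show ?thesis
    by (rule orbit_subprojectionsI [OF *(1-3) mvn_trans [OF *(4) assms(2)]])
qed

lemma orbit_subprojections_act:
  assumes \<delta>: "\<delta> \<in> carrier \<Gamma>" and r: "r \<in> orbit_subprojections p"
  shows "\<alpha> \<delta> r \<in> orbit_subprojections p"
  using r
proof (rule orbit_subprojectionsE)
  fix \<gamma> e assume *: "\<gamma> \<in> carrier \<Gamma>" "e \<in> projections M" "p o\<^sub>L e = e" "(\<alpha> \<gamma> e, r) \<in> mvn_rel M"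
  have "(\<alpha> (\<delta> \<otimes>\<^bsub>\<Gamma>\<^esub> \<gamma>) e, \<alpha> \<delta> r) \<in> mvn_rel M"
    using act_mvn [OF \<delta> *(4)] by (simp add: act_mult \<delta> * projectionsD(1))
  then show ?thesis
    by (intro orbit_subprojectionsI [OF _ *(2,3)]) (simp_all add: \<delta> *)
qed

text \<open>The partial isometry \<open>u\<close> between the translate of \<open>e\<close> and
  \<open>r\<close> carries \<open>r0\<close> to the equivalent projection \<open>g\<close> below
  that translate; moving \<open>g\<close> back by the inverse of \<gamma> gives a subprojection of
  \<open>e\<close>.\<close>

lemma orbit_subprojections_hereditary:
  assumes r: "r \<in> orbit_subprojections p" and r0: "r0 \<in> projections M" "r o\<^sub>L r0 = r0"
  shows "r0 \<in> orbit_subprojections p"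
  using r
proof (rule orbit_subprojectionsE)
  fix \<gamma> e assume \<gamma>: "\<gamma> \<in> carrier \<Gamma>" and e: "e \<in> projections M" "p o\<^sub>L e = e"
    and er: "(\<alpha> \<gamma> e, r) \<in> mvn_rel M"
  obtain u where u: "u \<in> M" "\<alpha> \<gamma> e = u o\<^sub>L adj u" "r = adj u o\<^sub>L u"
    using er unfolding mvn_rel_def by blast
  note P0 = projectionsD [OF r0(1)] and PE = projectionsD [OF e(1)]
  let ?\<delta> = "inv\<^bsub>\<Gamma>\<^esub> \<gamma>" and ?w = "u o\<^sub>L r0"
  define g where "g = ?w o\<^sub>L adj ?w"
  have w: "?w \<in> M" and \<delta>: "?\<delta> \<in> carrier \<Gamma>"
    using u(1) P0(1) \<gamma> by simp_all
  have w_adj: "adj ?w o\<^sub>L ?w = r0"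
  proof -
    have "adj ?w o\<^sub>L ?w = r0 o\<^sub>L (r o\<^sub>L r0)"
      using u(1) P0(1,2) by (simp add: u(3) blinfun_compose_assoc)
    then show ?thesis
      using r0(2) P0(3) by simp
  qed
  have g_r0: "(g, r0) \<in> mvn_rel M"
    using partial_isometry(2) [OF w] w_adj P0(3) unfolding g_def by simp
  then have g: "g \<in> projections M"
    by (simp add: mvn_proj)
  have gM: "g \<in> M" by (rule projectionsD(1) [OF g])
  have eg: "\<alpha> \<gamma> e o\<^sub>L g = g"
  proof -
    have "\<alpha> \<gamma> e o\<^sub>L ?w = u o\<^sub>L (r o\<^sub>L r0)"
      by (simp add: u(2,3) blinfun_compose_assoc)
    also have "\<dots> = ?w"
      using r0(2) by simp
    finally show ?thesis
      unfolding g_def by (simp flip: blinfun_compose_assoc)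
  qed
  let ?e' = "\<alpha> ?\<delta> g"
  have "e o\<^sub>L ?e' = ?e'"
  proof -
    have "\<alpha> ?\<delta> (\<alpha> \<gamma> e o\<^sub>L g) = e o\<^sub>L ?e'"
      by (simp add: act_comp [OF \<delta>] gM \<gamma> PE(1) act_inv_act)
    then show ?thesis
      by (simp add: eg)
  qed
  then have "p o\<^sub>L ?e' = ?e'"
    by (metis e(2) blinfun_compose_assoc)
  moreover have "(\<alpha> \<gamma> ?e', r0) \<in> mvn_rel M"
    using g_r0 by (simp add: act_act_inv \<gamma> gM)
  ultimately show ?thesis
    by (intro orbit_subprojectionsI [OF \<gamma> act_projection [OF \<delta> g]])
qed

text \<open>
  The projection produced here is the join of all projections equivalent to a translate of a
  subprojection of \<open>p\<close>, that is, the smallest invariant central projection above \<open>p\<close>.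
\<close>

lemma invariant_central_support:
  assumes p: "p \<in> projections M"
  shows "\<exists>z\<in>projections M. (\<forall>m\<in>M. z o\<^sub>L m = m o\<^sub>L z) \<and> (\<forall>\<gamma>\<in>carrier \<Gamma>. \<alpha> \<gamma> z = z) \<and>
    z o\<^sub>L p = p \<and>
    (\<forall>q\<in>projections M. (\<forall>r\<in>orbit_subprojections p. q o\<^sub>L r = r \<longrightarrow> r = 0) \<longrightarrow> z o\<^sub>L q = 0)"
proof -
  let ?S = "orbit_subprojections p"
  obtain Y where Y: "Y \<subseteq> ?S - {0}" and pw: "pairwise (\<lambda>x y. x o\<^sub>L y = 0) Y"
    and max: "\<forall>b\<in>?S - {0}. (\<forall>y\<in>Y. b o\<^sub>L y = 0 \<and> y o\<^sub>L b = 0) \<longrightarrow> b \<in> Y"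
    using maximal_pairwise [of "?S - {0}" "\<lambda>x y. x o\<^sub>L y = 0"] by (elim exE conjE)
  have Y_proj: "y \<in> projections M" if "y \<in> Y" for y
    using Y that orbit_subprojections_proj by blast
  have OY: "orthogonal_projections Y (\<lambda>y. y)"
    using pw Y_proj by (simp add: orthogonal_projections_def pairwise_def)
  obtain z where z: "z \<in> projections M" and zY: "strong_sum Y (\<lambda>y. y) z"
    by (rule strong_sum_projection [OF OY])
  note PZ = projectionsD [OF z]
  have id: "id_blinfun \<in> projections M"
    by (rule projectionsI) simp_all
  have cz: "id_blinfun - z \<in> projections M"
    by (rule proj_diff [OF z id]) simp
  have zy: "z o\<^sub>L y = y" if "y \<in> Y" for y
    by (rule strong_sum_ge [OF OY zY that])
  \<comment> \<open>Otherwise comparison gives a nonzero \<open>e\<close> below the complement of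
    \<open>z\<close>, equivalent to a subprojection of \<open>r\<close> and so in the set. It is
    orthogonal to all of \<open>Y\<close>, against maximality.\<close>
  have corner: "(id_blinfun - z) o\<^sub>L m o\<^sub>L r = 0" if m: "m \<in> M" and r: "r \<in> ?S" for m r
  proof (rule ccontr)
    assume "(id_blinfun - z) o\<^sub>L m o\<^sub>L r \<noteq> 0"
    then obtain e f where ef: "(e, f) \<in> mvn_rel M" "e \<noteq> 0" "(id_blinfun - z) o\<^sub>L e = e" "r o\<^sub>L f = f"
      by (rule comparison [OF m cz orbit_subprojections_proj [OF r]])
    have e: "e \<in> projections M" and f: "f \<in> projections M"
      using mvn_proj [OF ef(1)] by simp_all
    have "f \<in> ?S"
      by (rule orbit_subprojections_hereditary [OF r f ef(4)])
    then have "e \<in> ?S"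
      by (rule orbit_subprojections_mvn [OF _ mvn_sym [OF ef(1)]])
    have "(id_blinfun - z) o\<^sub>L e = e - (z o\<^sub>L e)"
      by (rule blinfun_eqI) (simp add: blinfun.diff_left)
    with ef(3) have ze: "z o\<^sub>L e = 0"
      by simp
    have "y o\<^sub>L e = 0" if y: "y \<in> Y" for y
    proof -
      have "y o\<^sub>L z = y"
        by (rule proj_comp_swap [OF z Y_proj [OF y] Y_proj [OF y] zy [OF y]])
      then have "y o\<^sub>L e = y o\<^sub>L (z o\<^sub>L e)"
        by (simp flip: blinfun_compose_assoc)
      then show ?thesis
        by (simp add: ze)
    qed
    then have "\<forall>y\<in>Y. e o\<^sub>L y = 0 \<and> y o\<^sub>L e = 0"
      using proj_comp_swap [OF Y_proj e zero_proj] by blast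
    then have "e \<in> Y"
      using max \<open>e \<in> ?S\<close> ef(2) by simp
    then show False
      using zy ze ef(2) by fastforce
  qed
  \<comment> \<open>Summing the corner relation over \<open>Y\<close> shows that every
    \<open>m\<close> maps the range of \<open>z\<close> into itself; the same for
    \<open>adj m\<close> gives commutation.\<close>
  have zmz: "m o\<^sub>L z = z o\<^sub>L m o\<^sub>L z" if m: "m \<in> M" for m
  proof -
    have "((id_blinfun - z) o\<^sub>L m) o\<^sub>L z = 0"
      by (rule strong_sum_comp_zero [OF zY]) (use corner [OF m] Y in blast)
    moreover have "((id_blinfun - z) o\<^sub>L m) o\<^sub>L z = (m o\<^sub>L z) - (z o\<^sub>L m o\<^sub>L z)"
      by (rule blinfun_eqI) (simp add: blinfun.diff_left)
    ultimately show ?thesis by simp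
  qed
  have central: "z o\<^sub>L m = m o\<^sub>L z" if m: "m \<in> M" for m
  proof -
    have "adj (adj m o\<^sub>L z) = adj (z o\<^sub>L adj m o\<^sub>L z)"
      by (rule arg_cong [OF zmz]) (simp add: m)
    then have "z o\<^sub>L m = z o\<^sub>L (m o\<^sub>L z)"
      using m PZ(1,2) by simp
    also have "\<dots> = m o\<^sub>L z"
      by (rule zmz [OF m, unfolded blinfun_compose_assoc, symmetric])
    finally show ?thesis .
  qed
  have zr: "z o\<^sub>L r = r" if r: "r \<in> ?S" for r
  proof -
    have "(id_blinfun - z) o\<^sub>L id_blinfun o\<^sub>L r = r - (z o\<^sub>L r)"
      by (rule blinfun_eqI) (simp add: blinfun.diff_left)
    then show ?thesis
      using corner [OF id_in r] by simp
  qed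
  \<comment> \<open>Each \<open>y\<close> in \<open>Y\<close> translated by the inverse of \<gamma>
    is still in the set, hence below \<open>z\<close>; moving back puts \<open>y\<close> below the
    translate of \<open>z\<close>. Using this for \<gamma> and its inverse yields equality.\<close>
  have act_ge: "\<alpha> \<gamma> z o\<^sub>L z = z" if \<gamma>: "\<gamma> \<in> carrier \<Gamma>" for \<gamma>
  proof (rule strong_sum_least [OF zY])
    fix y assume y: "y \<in> Y"
    let ?y = "\<alpha> (inv\<^bsub>\<Gamma>\<^esub> \<gamma>) y"
    have yM: "y \<in> M"
      by (rule projectionsD(1) [OF Y_proj [OF y]])
    have "?y \<in> ?S"
      using Y y by (intro orbit_subprojections_act) (auto simp: \<gamma>)
    then have "\<alpha> \<gamma> (z o\<^sub>L ?y) = \<alpha> \<gamma> ?y"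
      by (simp add: zr)
    then show "\<alpha> \<gamma> z o\<^sub>L y = y"
      by (simp add: act_comp \<gamma> PZ(1) yM act_act_inv)
  qed
  have act_z: "\<alpha> \<gamma> z = z" if \<gamma>: "\<gamma> \<in> carrier \<Gamma>" for \<gamma>
  proof (rule proj_antisym [OF act_projection [OF \<gamma> z] z _ act_ge [OF \<gamma>]])
    have "\<alpha> \<gamma> (\<alpha> (inv\<^bsub>\<Gamma>\<^esub> \<gamma>) z o\<^sub>L z) = \<alpha> \<gamma> z"
      using act_ge [of "inv\<^bsub>\<Gamma>\<^esub> \<gamma>"] \<gamma> by simp
    then show "z o\<^sub>L \<alpha> \<gamma> z = \<alpha> \<gamma> z"
      by (simp add: act_comp \<gamma> PZ(1) act_act_inv)
  qed
  have zq: "z o\<^sub>L q = 0"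
    if q: "q \<in> projections M" and none: "\<forall>r\<in>?S. q o\<^sub>L r = r \<longrightarrow> r = 0" for q
  proof -
    have "q o\<^sub>L z = 0"
    proof (rule strong_sum_comp_zero [OF zY], rule ccontr)
      fix y assume y: "y \<in> Y" and "q o\<^sub>L y \<noteq> 0"
      then have "q o\<^sub>L id_blinfun o\<^sub>L y \<noteq> 0"
        by simp
      then obtain e f where ef: "(e, f) \<in> mvn_rel M" "e \<noteq> 0" "q o\<^sub>L e = e" "y o\<^sub>L f = f"
        by (rule comparison [OF id_in q Y_proj [OF y]])
      have "f \<in> ?S"
        using Y y mvn_proj [OF ef(1)] by (intro orbit_subprojections_hereditary [OF _ _ ef(4)]) auto
      then have "e \<in> ?S"
        by (rule orbit_subprojections_mvn [OF _ mvn_sym [OF ef(1)]])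
      then show False
        using none ef(2,3) by simp
    qed
    then show ?thesis
      by (rule proj_comp_swap [OF q z zero_proj])
  qed
  show ?thesis
    by (rule bexI [OF _ z], intro conjI ballI impI)
      (rule zr [OF orbit_subprojections_self [OF p]] | rule central act_z zq, assumption+)+
qed

section \<open>Matching pieces of the two projections\<close>

lemma mvn_zero:
  assumes "(0, f) \<in> mvn_rel M" shows "f = 0"
proof -
  obtain u where u: "u \<in> M" "0 = u o\<^sub>L adj u" "f = adj u o\<^sub>L u"
    using assms unfolding mvn_rel_def by blast
  have "f = f o\<^sub>L f"
    using mvn_proj [OF assms] projectionsD(3) by simp
  also have "\<dots> = adj u o\<^sub>L (u o\<^sub>L adj u) o\<^sub>L u"
    by (simp add: u(3) blinfun_compose_assoc)
  finally show ?thesis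
    by (simp flip: u(2))
qed

text \<open>Regroups a family by the label \<open>k t\<close>. Associativity is obtained from the
  least upper bound property, so no iterated series has to be rearranged.\<close>

lemma partition_strong_sum:
  assumes e: "orthogonal_projections X e" and E: "E \<in> projections M" "strong_sum X e E"
    and P: "\<And>\<gamma>. \<gamma> \<in> J \<Longrightarrow> P \<gamma> \<in> projections M"
    and PS: "\<And>\<gamma>. \<gamma> \<in> J \<Longrightarrow> strong_sum {t \<in> X. k t = \<gamma>} e (P \<gamma>)"
    and k: "\<And>t. t \<in> X \<Longrightarrow> k t \<in> J"
  shows "\<gamma> \<in> J \<Longrightarrow> \<delta> \<in> J \<Longrightarrow> \<gamma> \<noteq> \<delta> \<Longrightarrow> P \<gamma> o\<^sub>L P \<delta> = 0" and "is_join M J P E"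
proof -
  have sub: "orthogonal_projections {t \<in> X. k t = \<gamma>} e" for \<gamma>
    using e by (simp add: orthogonal_projections_def)
  have ep: "e t \<in> projections M" if "t \<in> X" for t
    by (rule orthogonal_projectionsD(1) [OF e that])
  have Pe: "P (k t) o\<^sub>L e t = e t" if "t \<in> X" for t
    using strong_sum_ge [OF sub PS [OF k [OF that]]] that by simp
  show "P \<gamma> o\<^sub>L P \<delta> = 0" if \<gamma>\<delta>: "\<gamma> \<in> J" "\<delta> \<in> J" "\<gamma> \<noteq> \<delta>" for \<gamma> \<delta>
  proof (rule strong_sum_comp_zero [OF PS [OF \<gamma>\<delta>(2)]])
    fix t assume t: "t \<in> {t \<in> X. k t = \<delta>}"
    have "e t o\<^sub>L P \<gamma> = 0"
    proof (rule strong_sum_comp_zero [OF PS [OF \<gamma>\<delta>(1)]])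
      fix s assume "s \<in> {t \<in> X. k t = \<gamma>}"
      then show "e t o\<^sub>L e s = 0"
        using t \<gamma>\<delta>(3) by (intro orthogonal_projectionsD(2) [OF e]) auto
    qed
    then show "P \<gamma> o\<^sub>L e t = 0"
      using t by (intro proj_comp_swap [OF ep P [OF \<gamma>\<delta>(1)] zero_proj]) auto
  qed
  have "E o\<^sub>L P \<gamma> = P \<gamma>" if "\<gamma> \<in> J" for \<gamma>
    by (rule strong_sum_least [OF PS [OF that]]) (use strong_sum_ge [OF e E(2)] in auto)
  moreover have "r o\<^sub>L E = E"
    if r: "r \<in> projections M" and ge: "\<And>\<gamma>. \<gamma> \<in> J \<Longrightarrow> r o\<^sub>L P \<gamma> = P \<gamma>" for r
  proof (rule strong_sum_least [OF E(2)])
    fix t assume t: "t \<in> X"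
    have "r o\<^sub>L e t = (r o\<^sub>L P (k t)) o\<^sub>L e t"
      by (simp add: blinfun_compose_assoc Pe t)
    then show "r o\<^sub>L e t = e t"
      by (simp add: ge k Pe t)
  qed
  ultimately show "is_join M J P E"
    unfolding is_join_def using E(1) by (simp add: le_op_proj P)
qed

lemma class_sumI:
  assumes "countable J" "\<And>\<gamma>. \<gamma> \<in> J \<Longrightarrow> P \<gamma> \<in> a \<gamma>" "\<And>\<gamma>. \<gamma> \<in> J \<Longrightarrow> a \<gamma> \<in> mvn_classes M"
    "\<And>\<gamma> \<delta>. \<gamma> \<in> J \<Longrightarrow> \<delta> \<in> J \<Longrightarrow> \<gamma> \<noteq> \<delta> \<Longrightarrow> P \<gamma> o\<^sub>L P \<delta> = 0" "is_join M J P s"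
  shows "class_sum M J a (mvn_class M s)"
  unfolding class_sum_def using assms by (intro conjI exI [of _ P] exI [of _ s]) auto

text \<open>With \<open>e\<close> nonzero, \<open>f\<close> is nonzero too. Admitting
  \<open>e = 0\<close> would supply trivial pieces of any pair, and exhaustion could not be
  expressed by emptiness.\<close>

definition pieces :: "('h \<Rightarrow>\<^sub>L 'h) \<Rightarrow> ('h \<Rightarrow>\<^sub>L 'h) \<Rightarrow> (('h \<Rightarrow>\<^sub>L 'h) \<times> ('h \<Rightarrow>\<^sub>L 'h) \<times> 'g) set" where
  "pieces p q = {(e, f, \<gamma>). e \<in> projections M \<and> e \<noteq> 0 \<and> p o\<^sub>L e = e \<and> q o\<^sub>L f = f \<and>
     \<gamma> \<in> carrier \<Gamma> \<and> (\<alpha> \<gamma> e, f) \<in> mvn_rel M}"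

lemma piecesD:
  assumes "t \<in> pieces p q"
  shows "fst t \<in> projections M" "p o\<^sub>L fst t = fst t" "q o\<^sub>L fst (snd t) = fst (snd t)"
    "snd (snd t) \<in> carrier \<Gamma>" "(\<alpha> (snd (snd t)) (fst t), fst (snd t)) \<in> mvn_rel M"
    "fst (snd t) \<in> projections M"
proof -
  show *: "fst t \<in> projections M" "p o\<^sub>L fst t = fst t" "q o\<^sub>L fst (snd t) = fst (snd t)"
    "snd (snd t) \<in> carrier \<Gamma>" "(\<alpha> (snd (snd t)) (fst t), fst (snd t)) \<in> mvn_rel M"
    using assms by (auto simp: pieces_def)
  show "fst (snd t) \<in> projections M"
    using mvn_proj [OF *(5)] by simp
qed

text \<open>All pieces with the same \<gamma> are joined into \<open>P \<gamma>\<close> and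
  \<open>Q \<gamma>\<close>. The translate of the former is equivalent to the latter because
  automorphisms and equivalence both respect orthogonal sums; this leaves a family indexed by
  \<Gamma>, however large \<open>X\<close> is.\<close>

lemma equidecomposable_of_matching:
  assumes count: "countable (carrier \<Gamma>)"
    and X: "X \<subseteq> pieces p q"
    and e: "orthogonal_projections X fst" and f: "orthogonal_projections X (\<lambda>t. fst (snd t))"
    and E: "E \<in> projections M" "strong_sum X fst E"
    and F: "F \<in> projections M" "strong_sum X (\<lambda>t. fst (snd t)) F"
  shows "equidecomposable \<Gamma> M \<alpha> (mvn_class M E) (mvn_class M F)"
proof -
  let ?k = "\<lambda>t. snd (snd t)" and ?f = "\<lambda>t. fst (snd t)"
  let ?X = "\<lambda>\<gamma>. {t \<in> X. ?k t = \<gamma>}"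
  have k: "?k t \<in> carrier \<Gamma>" if "t \<in> X" for t
    using X that unfolding pieces_def by auto
  have eX: "orthogonal_projections (?X \<gamma>) fst" and fX: "orthogonal_projections (?X \<gamma>) ?f" for \<gamma>
    using e f by (simp_all add: orthogonal_projections_def)
  have "\<exists>P. P \<in> projections M \<and> strong_sum (?X \<gamma>) fst P" for \<gamma>
    by (rule strong_sum_projection [OF eX]) blast
  then have "\<exists>P. \<forall>\<gamma>. P \<gamma> \<in> projections M \<and> strong_sum (?X \<gamma>) fst (P \<gamma>)"
    by (intro choice) simp
  then obtain P where P: "\<And>\<gamma>. P \<gamma> \<in> projections M" "\<And>\<gamma>. strong_sum (?X \<gamma>) fst (P \<gamma>)"
    by blast
  have "\<exists>Q. Q \<in> projections M \<and> strong_sum (?X \<gamma>) ?f Q" for \<gamma>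
    by (rule strong_sum_projection [OF fX]) blast
  then have "\<exists>Q. \<forall>\<gamma>. Q \<gamma> \<in> projections M \<and> strong_sum (?X \<gamma>) ?f (Q \<gamma>)"
    by (intro choice) simp
  then obtain Q where Q: "\<And>\<gamma>. Q \<gamma> \<in> projections M" "\<And>\<gamma>. strong_sum (?X \<gamma>) ?f (Q \<gamma>)"
    by blast
  have PQ: "(\<alpha> \<gamma> (P \<gamma>), Q \<gamma>) \<in> mvn_rel M" if \<gamma>: "\<gamma> \<in> carrier \<Gamma>" for \<gamma>
  proof (rule mvn_strong_sum [OF act_orthogonal_projections [OF \<gamma> eX [of \<gamma>]] fX [of \<gamma>]
        act_projection [OF \<gamma> P(1)] act_strong_sum [OF \<gamma> eX P] Q])
    show "(\<alpha> \<gamma> (fst t), ?f t) \<in> mvn_rel M" if "t \<in> ?X \<gamma>" for t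
      using that X unfolding pieces_def by auto
  qed
  note PP = partition_strong_sum [OF e E P(1) P(2) k] and QQ = partition_strong_sum [OF f F Q(1) Q(2) k]
  define a where "a \<gamma> = mvn_class M (P \<gamma>)" for \<gamma>
  have a: "a \<gamma> \<in> mvn_classes M" for \<gamma>
    unfolding a_def by (rule mvn_class_in_classes [OF P(1)])
  have ca: "class_action M \<alpha> \<gamma> (a \<gamma>) = mvn_class M (\<alpha> \<gamma> (P \<gamma>))" if "\<gamma> \<in> carrier \<Gamma>" for \<gamma>
    unfolding a_def by (rule class_action_mvn_class [OF that P(1)])
  have "class_sum M (carrier \<Gamma>) a (mvn_class M E)"
  proof (rule class_sumI [OF count, of P])
    show "P \<gamma> \<in> a \<gamma>" for \<gamma>
      unfolding a_def by (simp add: mem_mvn_class mvn_refl P(1))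
  qed (use a PP in auto)
  moreover have "class_sum M (carrier \<Gamma>) (\<lambda>\<gamma>. class_action M \<alpha> \<gamma> (a \<gamma>)) (mvn_class M F)"
  proof (rule class_sumI [OF count, of Q])
    show "Q \<gamma> \<in> class_action M \<alpha> \<gamma> (a \<gamma>)" if "\<gamma> \<in> carrier \<Gamma>" for \<gamma>
      using PQ [OF that] by (simp add: ca that mem_mvn_class)
    show "class_action M \<alpha> \<gamma> (a \<gamma>) \<in> mvn_classes M" if "\<gamma> \<in> carrier \<Gamma>" for \<gamma>
      by (simp add: ca that mvn_class_in_classes act_projection P(1))
  qed (use QQ in auto)
  ultimately show ?thesis
    unfolding equidecomposable_def using a by blast
qed

lemma maximal_matching:
  assumes p: "p \<in> projections M" and q: "q \<in> projections M"
  obtains X E F where "X \<subseteq> pieces p q"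
    "orthogonal_projections X fst" "E \<in> projections M" "strong_sum X fst E" "p o\<^sub>L E = E"
    "orthogonal_projections X (\<lambda>t. fst (snd t))" "F \<in> projections M"
    "strong_sum X (\<lambda>t. fst (snd t)) F" "q o\<^sub>L F = F"
    "pieces (p - E) (q - F) = {}"
proof -
  \<comment> \<open>Orthogonality in both coordinates at once, so that a single maximal family
    yields orthogonal families below \<open>p\<close> and below \<open>q\<close>.\<close>
  let ?R = "\<lambda>s t. fst s o\<^sub>L fst t = 0 \<and> fst (snd s) o\<^sub>L fst (snd t) = 0"
  obtain X where X: "X \<subseteq> pieces p q" and pw: "pairwise ?R X"
    and max: "\<forall>b\<in>pieces p q. (\<forall>t\<in>X. ?R b t \<and> ?R t b) \<longrightarrow> b \<in> X"
    using maximal_pairwise [of "pieces p q" ?R] by (elim exE conjE)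
  have XD: "fst t \<in> projections M" "fst (snd t) \<in> projections M" "p o\<^sub>L fst t = fst t"
    "q o\<^sub>L fst (snd t) = fst (snd t)" if "t \<in> X" for t
    using piecesD [of t p q] X that by auto
  have e: "orthogonal_projections X fst" and f: "orthogonal_projections X (\<lambda>t. fst (snd t))"
    using pw XD(1,2) by (simp_all add: orthogonal_projections_def pairwise_def)
  obtain E where E: "E \<in> projections M" "strong_sum X fst E"
    by (rule strong_sum_projection [OF e])
  obtain F where F: "F \<in> projections M" "strong_sum X (\<lambda>t. fst (snd t)) F"
    by (rule strong_sum_projection [OF f])
  have pE: "p o\<^sub>L E = E" and qF: "q o\<^sub>L F = F"
    by (rule strong_sum_least [OF E(2)], erule XD(3), rule strong_sum_least [OF F(2)], erule XD(4))
  \<comment> \<open>Stated for arbitrary \<open>p\<close>, \<open>h\<close> and \<open>E\<close>, as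
    it is needed on both sides: what lies below the remainder lies below the whole and is orthogonal
    to every chosen piece.\<close>
  have rest: "p o\<^sub>L g = g \<and> (\<forall>t\<in>X. h t o\<^sub>L g = 0 \<and> g o\<^sub>L h t = 0)"
    if p: "p \<in> projections M" and h: "orthogonal_projections X h"
      and E: "E \<in> projections M" "strong_sum X h E" and pE: "p o\<^sub>L E = E"
      and g: "g \<in> projections M" "(p - E) o\<^sub>L g = g" for p h E g
  proof -
    have Ep: "E o\<^sub>L p = E"
      by (rule proj_comp_swap [OF p E(1) E(1) pE])
    have "E o\<^sub>L (p - E) = (E o\<^sub>L p) - (E o\<^sub>L E)" "p o\<^sub>L (p - E) = (p o\<^sub>L p) - (p o\<^sub>L E)"
      by (rule blinfun_eqI, simp add: blinfun.diff_left blinfun.diff_right)+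
    then have 1: "E o\<^sub>L (p - E) = 0" "p o\<^sub>L (p - E) = p - E"
      using projectionsD(3) [OF E(1)] projectionsD(3) [OF p] Ep pE by simp_all
    have Eg: "E o\<^sub>L g = 0" and pg: "p o\<^sub>L g = g"
      using arg_cong [OF 1(1), of "\<lambda>t. t o\<^sub>L g"] arg_cong [OF 1(2), of "\<lambda>t. t o\<^sub>L g"] g(2)
      by (simp_all add: blinfun_compose_assoc)
    have "h t o\<^sub>L g = 0" if t: "t \<in> X" for t
    proof -
      have ht: "h t \<in> projections M"
        by (rule orthogonal_projectionsD(1) [OF h t])
      have "h t o\<^sub>L E = h t"
        by (rule proj_comp_swap [OF E(1) ht ht strong_sum_ge [OF h E(2) t]])
      then have "h t o\<^sub>L g = h t o\<^sub>L (E o\<^sub>L g)"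
        by (simp flip: blinfun_compose_assoc)
      then show ?thesis
        by (simp add: Eg)
    qed
    then show ?thesis
      using pg proj_comp_swap [OF orthogonal_projectionsD(1) [OF h] g(1) zero_proj] by blast
  qed
  have "(e', f', \<gamma>) \<notin> pieces (p - E) (q - F)" for e' f' \<gamma>
  proof
    assume "(e', f', \<gamma>) \<in> pieces (p - E) (q - F)"
    then have *: "e' \<in> projections M" "e' \<noteq> 0" "(p - E) o\<^sub>L e' = e'" "(q - F) o\<^sub>L f' = f'"
      "\<gamma> \<in> carrier \<Gamma>" "(\<alpha> \<gamma> e', f') \<in> mvn_rel M"
      unfolding pieces_def by auto
    have f': "f' \<in> projections M"
      using mvn_proj [OF *(6)] by simp
    note re = rest [OF p e E pE *(1,3)] and rf = rest [OF q f F qF f' *(4)]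
    have "(e', f', \<gamma>) \<in> pieces p q"
      using * re rf unfolding pieces_def by simp
    then have in_X: "(e', f', \<gamma>) \<in> X"
      using max re rf by simp
    \<comment> \<open>Maximality puts the new piece into \<open>X\<close>, to all of whose members
      it is orthogonal, itself included.\<close>
    then have "e' o\<^sub>L e' = 0"
      using re by fastforce
    then show False
      using projectionsD(3) [OF *(1)] *(2) by simp
  qed
  then have "pieces (p - E) (q - F) = {}"
    by (auto simp del: split_paired_All)
  then show ?thesis
    by (rule that [OF X e E pE f F qF])
qed

lemma trace_eq_imp_equidecomposable:
  assumes count: "countable (carrier \<Gamma>)"
    and \<tau>: "vna_trace M \<tau>" "normal_trace M \<tau>" "finite_trace M \<tau>" "invariant_trace \<Gamma> M \<alpha> \<tau>"
    and faithful: "faithful_trace M \<tau>"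
    and p: "p \<in> projections M" and q: "q \<in> projections M"
    and agree: "\<And>\<sigma>. \<lbrakk>vna_trace M \<sigma>; finite_trace M \<sigma>; normal_trace M \<sigma>; invariant_trace \<Gamma> M \<alpha> \<sigma>\<rbrakk>
      \<Longrightarrow> \<sigma> p = \<sigma> q"
  shows "equidecomposable \<Gamma> M \<alpha> (mvn_class M p) (mvn_class M q)"
proof -
  let ?f = "\<lambda>t. fst (snd t)"
  obtain X E F where X: "X \<subseteq> pieces p q"
    and e: "orthogonal_projections X fst" and E: "E \<in> projections M" "strong_sum X fst E" and pE: "p o\<^sub>L E = E"
    and f: "orthogonal_projections X ?f" and F: "F \<in> projections M" "strong_sum X ?f F" and qF: "q o\<^sub>L F = F"
    and none: "pieces (p - E) (q - F) = {}"
    by (rule maximal_matching [OF p q])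
  have p': "p - E \<in> projections M" and q': "q - F \<in> projections M"
    by (intro proj_diff p q E F pE qF)+
  have rest: "\<sigma> p = \<sigma> E + \<sigma> (p - E)" "\<sigma> q = \<sigma> E + \<sigma> (q - F)" "\<sigma> E \<noteq> \<infinity>"
    if \<sigma>: "vna_trace M \<sigma>" "finite_trace M \<sigma>" "normal_trace M \<sigma>" "invariant_trace \<Gamma> M \<alpha> \<sigma>" for \<sigma>
  proof -
    have "\<sigma> (fst t) = \<sigma> (?f t)" if t: "t \<in> X" for t
    proof -
      have k: "snd (snd t) \<in> carrier \<Gamma>" and ef: "(\<alpha> (snd (snd t)) (fst t), ?f t) \<in> mvn_rel M"
        using X t unfolding pieces_def by auto
      have "\<sigma> (fst t) = \<sigma> (\<alpha> (snd (snd t)) (fst t))"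
        using \<sigma>(4) k proj_positive [OF orthogonal_projectionsD(1) [OF e t]]
        by (simp add: invariant_trace_def)
      also have "\<dots> = \<sigma> (?f t)"
        by (rule trace_mvn [OF \<sigma>(1) ef])
      finally show ?thesis .
    qed
    then have "((\<lambda>t. \<sigma> (fst t)) has_sum \<sigma> F) X \<longleftrightarrow> ((\<lambda>t. \<sigma> (?f t)) has_sum \<sigma> F) X"
      by (intro has_sum_cong)
    then have EF: "\<sigma> E = \<sigma> F"
      using trace_strong_sum [OF \<sigma>(1,3) e E] trace_strong_sum [OF \<sigma>(1,3) f F] has_sum_unique
      by blast
    show "\<sigma> p = \<sigma> E + \<sigma> (p - E)" "\<sigma> q = \<sigma> E + \<sigma> (q - F)"
      using trace_add [OF \<sigma>(1) proj_positive [OF E(1)] proj_positive [OF p']]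
        trace_add [OF \<sigma>(1) proj_positive [OF F(1)] proj_positive [OF q']] EF by simp_all
    show "\<sigma> E \<noteq> \<infinity>"
      using \<sigma>(2) proj_positive [OF E(1)] unfolding finite_trace_def by auto
  qed
  obtain z where z: "z \<in> projections M" and central: "\<forall>m\<in>M. z o\<^sub>L m = m o\<^sub>L z"
    and inv_z: "\<forall>\<gamma>\<in>carrier \<Gamma>. \<alpha> \<gamma> z = z" and zp: "z o\<^sub>L (p - E) = p - E"
    and zq: "\<forall>q\<in>projections M. (\<forall>r\<in>orbit_subprojections (p - E). q o\<^sub>L r = r \<longrightarrow> r = 0) \<longrightarrow>
      z o\<^sub>L q = 0"
    using invariant_central_support [OF p'] by (elim bexE conjE)
  have zM: "z \<in> M"
    by (rule projectionsD(1) [OF z])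
  \<comment> \<open>A nonzero \<open>r\<close> below \<open>q - F\<close> in the orbit set of
    \<open>p - E\<close> would come from some \<open>e\<close> and \<gamma> forming a further
    piece.\<close>
  have zq': "z o\<^sub>L (q - F) = 0"
  proof (rule zq [rule_format, OF q'], rule ccontr)
    fix r assume r: "r \<in> orbit_subprojections (p - E)" "(q - F) o\<^sub>L r = r" "r \<noteq> 0"
    from r(1) obtain \<gamma> e where *: "\<gamma> \<in> carrier \<Gamma>" "e \<in> projections M" "(p - E) o\<^sub>L e = e" "(\<alpha> \<gamma> e, r) \<in> mvn_rel M"
      by (rule orbit_subprojectionsE)
    have "e \<noteq> 0"
      using *(1,4) r(3) mvn_zero act_zero by auto
    with * r(2) have "(e, r, \<gamma>) \<in> pieces (p - E) (q - F)"
      unfolding pieces_def by simp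
    with none show False by simp
  qed
  let ?\<sigma> = "\<lambda>x. \<tau> (z o\<^sub>L (x o\<^sub>L z))"
  note \<sigma> = compressed_trace [OF z central [rule_format] \<tau>(1,3,2)]
  have inv: "invariant_trace \<Gamma> M \<alpha> ?\<sigma>"
    unfolding invariant_trace_def
  proof (intro ballI)
    fix \<gamma> m assume \<gamma>: "\<gamma> \<in> carrier \<Gamma>" and m: "m \<in> positives M"
    have mM: "m \<in> M"
      using m by (simp add: positives_def)
    have "z o\<^sub>L (\<alpha> \<gamma> m o\<^sub>L z) = \<alpha> \<gamma> (z o\<^sub>L (m o\<^sub>L z))"
      by (simp add: act_comp \<gamma> zM mM inv_z)
    then show "?\<sigma> (\<alpha> \<gamma> m) = ?\<sigma> m"
      using \<tau>(4) \<gamma> compress_positive [OF z m] by (simp add: invariant_trace_def)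
  qed
  have pz: "(p - E) o\<^sub>L z = p - E" and qz: "(q - F) o\<^sub>L z = 0"
    by (rule proj_comp_swap [OF z p' p' zp], rule proj_comp_swap [OF z q' zero_proj zq'])
  \<comment> \<open>Cancelling the matched part in \<open>ennreal\<close> is legitimate as its value
    is finite. The compressed trace keeps the value of \<tau> at \<open>p - E\<close> and vanishes
    at \<open>q - F\<close>.\<close>
  have "?\<sigma> E + ?\<sigma> (p - E) = ?\<sigma> E + ?\<sigma> (q - F)"
    using agree [OF \<sigma> inv] rest(1,2) [OF \<sigma> inv] by simp
  then have "?\<sigma> (p - E) = ?\<sigma> (q - F)"
    using rest(3) [OF \<sigma> inv] by (simp add: ennreal_add_left_cancel)
  then have "\<tau> (p - E) = 0"
    by (simp add: pz zp qz trace_zero [OF \<tau>(1)])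
  moreover have "\<tau> E + \<tau> (p - E) = \<tau> E + \<tau> (q - F)"
    using agree [OF \<tau>(1,3,2,4)] rest(1,2) [OF \<tau>(1,3,2,4)] by simp
  then have "\<tau> (p - E) = \<tau> (q - F)"
    using rest(3) [OF \<tau>(1,3,2,4)] by (simp add: ennreal_add_left_cancel)
  ultimately have "p - E = 0" "q - F = 0"
    using faithful proj_positive [OF p'] proj_positive [OF q'] unfolding faithful_trace_def by auto
  then show ?thesis
    using equidecomposable_of_matching [OF count X e f E F] by simp
qed

end

theorem theorem4p1:
  fixes \<Gamma> :: "('g, 'm) monoid_scheme"
    and M :: "('h::chilbert_space \<Rightarrow>\<^sub>L 'h) set"
    and \<alpha> :: "'g \<Rightarrow> ('h \<Rightarrow>\<^sub>L 'h) \<Rightarrow> ('h \<Rightarrow>\<^sub>L 'h)"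
    and p q :: "'h \<Rightarrow>\<^sub>L 'h"
  assumes "group \<Gamma>" and "countable (carrier \<Gamma>)"
    and "von_neumann_algebra M" and "finite_vna M"
    and "vna_action \<Gamma> M \<alpha>"
    and "\<exists>\<tau>. vna_trace M \<tau> \<and> faithful_trace M \<tau> \<and> normal_trace M \<tau> \<and> finite_trace M \<tau> \<and>
             invariant_trace \<Gamma> M \<alpha> \<tau>"
    and "p \<in> projections M" and "q \<in> projections M"
  shows "(\<forall>\<tau>. vna_trace M \<tau> \<and> finite_trace M \<tau> \<and> normal_trace M \<tau> \<and> invariant_trace \<Gamma> M \<alpha> \<tau>
            \<longrightarrow> \<tau> p = \<tau> q)
         \<longleftrightarrow> equidecomposable \<Gamma> M \<alpha> (mvn_class M p) (mvn_class M q)"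
proof -
  interpret vna_dynamics \<Gamma> M \<alpha>
    by (intro vna_dynamics.intro vna.intro vna_dynamics_axioms.intro assms)
  obtain \<tau> where \<tau>: "vna_trace M \<tau>" "faithful_trace M \<tau>" "normal_trace M \<tau>" "finite_trace M \<tau>"
    "invariant_trace \<Gamma> M \<alpha> \<tau>"
    using assms(6) by blast
  show ?thesis
    using trace_eq_imp_equidecomposable [OF assms(2) \<tau>(1,3,4,5,2) assms(7,8)]
      equidecomposable_imp_trace_eq [OF _ _ _ assms(7,8)] by blast
qed

end
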